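(* Let $\alpha$ be a $\|\cdot\|_{1}$-dominating normalized gauge norm on $L^{\infty}(\mathbb{T},\mu)$. If $k\in L^{\infty}(\mathbb{T},\mu)$ and $k^{-1}\in L^{\alpha}(\mathbb{T},\mu)$, then there are a unimodular function $u\in L^{\infty}(\mathbb{T},\mu)$ and an outer function $s\in H^{\infty}(\mathbb{T},\mu)$ such that $k=us$ and $s^{-1}\in H^{\alpha}(\mathbb{T},\mu)$.
   Context: $\mathbb{T}$ is the unit circle and $\mu$ is normalized arc length. A norm $\alpha$ on $L^{\infty}(\mathbb{T},\mu)$ is a normalized gauge norm if $\alpha(1)=1$ and $\alpha(|f|)=\alpha(f)$ for all $f$; it is $\|\cdot\|_1$-dominating if there is $c>0$ with $\alpha(f)\ge c\|f\|_{1}$ for all $f\in L^{\infty}(\mathbb{T},\mu)$. Such $\alpha$ is extended to all measurable $f$ by $\alpha(f)=\sup\{\alpha(s): s \text{ simple},\ 0\le s\le |f|\}\in[0,\infty]$. Put $\mathcal{L}^{\alpha}(\mathbb{T},\mu)=\{f \text{ measurable}:\alpha(f)<\infty\}\subset L^1(\mathbb{T},\mu)$, and let $L^{\alpha}(\mathbb{T},\mu)$ be the $\alpha$-closure of $L^{\infty}(\mathbb{T},\mu)$ in $\mathcal{L}^{\alpha}(\mathbb{T},\mu)$. The dual norm is $\alpha'(f)=\sup\{|\int_{\mathbb{T}} fh\,d\mu| : h\in L^{\infty}(\mathbb{T},\mu),\ \alpha(h)\le 1\}$ for $f\in L^{\infty}(\mathbb{T},\mu)$, extended to measurable functions in the same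 way; $\mathcal{L}^{\alpha'}(\mathbb{T},\mu)=\{f \text{ measurable}:\alpha'(f)<\infty\}$. $\sigma(L^{\alpha},\mathcal{L}^{\alpha'})$ is the weakest topology on $L^{\alpha}(\mathbb{T},\mu)$ making all functionals $f\mapsto\int_{\mathbb{T}} fg\,d\mu$, $g\in\mathcal{L}^{\alpha'}(\mathbb{T},\mu)$, continuous. $H^{\infty}(\mathbb{T},\mu)$ is the classical Hardy space, and $H^{\alpha}(\mathbb{T},\mu)$ is the closure of $H^{\infty}(\mathbb{T},\mu)$ in $L^{\alpha}(\mathbb{T},\mu)$ in the topology $\sigma(L^{\alpha},\mathcal{L}^{\alpha'})$. Unimodular means of modulus $1$ a.e.; outer is in the usual sense of Hardy space theory; $k^{-1}=1/k$ is the pointwise reciprocal. *)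

theory Defs
  imports "HOL-Analysis.Analysis"
begin

text \<open>
  Elements of the function spaces below are represented by Borel measurable functions on the
  circle rather than by classes modulo null sets; identities between such elements are therefore
  stated almost everywhere. Functions have type \<^typ>\<open>complex \<Rightarrow> complex\<close>, but only their values
  on the unit circle matter.
\<close>

definition circle_measure :: "complex measure" (\<open>\<mu>\<^sub>T\<close>) where
  "\<mu>\<^sub>T = distr (uniform_measure lborel {0..2 * pi}) (restrict_space borel (sphere 0 1)) cis"

definition Linf :: "(complex \<Rightarrow> complex) set" where
  "Linf = {f \<in> borel_measurable \<mu>\<^sub>T. \<exists>C. AE z in \<mu>\<^sub>T. cmod (f z) \<le> C}"

text \<open>
  Only the values of \<open>\<alpha>\<close> on \<^const>\<open>Linf\<close> are relevant. That \<open>\<alpha>\<close> depends only on the class of its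
  argument follows from definiteness and the triangle inequality.
\<close>

definition norm_on_Linf :: "((complex \<Rightarrow> complex) \<Rightarrow> real) \<Rightarrow> bool" where
  "norm_on_Linf \<alpha> \<longleftrightarrow>
     (\<forall>f\<in>Linf. 0 \<le> \<alpha> f) \<and>
     (\<forall>f\<in>Linf. \<alpha> f = 0 \<longleftrightarrow> (AE z in \<mu>\<^sub>T. f z = 0)) \<and>
     (\<forall>f\<in>Linf. \<forall>c. \<alpha> (\<lambda>z. c * f z) = cmod c * \<alpha> f) \<and>
     (\<forall>f\<in>Linf. \<forall>g\<in>Linf. \<alpha> (\<lambda>z. f z + g z) \<le> \<alpha> f + \<alpha> g)"

definition normalized_gauge_norm :: "((complex \<Rightarrow> complex) \<Rightarrow> real) \<Rightarrow> bool" where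
  "normalized_gauge_norm \<alpha> \<longleftrightarrow>
     norm_on_Linf \<alpha> \<and> \<alpha> (\<lambda>z. 1) = 1 \<and>
     (\<forall>f\<in>Linf. \<alpha> (\<lambda>z. complex_of_real (cmod (f z))) = \<alpha> f)"

definition L1_dominating :: "((complex \<Rightarrow> complex) \<Rightarrow> real) \<Rightarrow> bool" where
  "L1_dominating \<alpha> \<longleftrightarrow> (\<exists>c>0. \<forall>f\<in>Linf. \<alpha> f \<ge> c * (\<integral>z. cmod (f z) \<partial>\<mu>\<^sub>T))"

definition ext_norm :: "((complex \<Rightarrow> complex) \<Rightarrow> real) \<Rightarrow> (complex \<Rightarrow> complex) \<Rightarrow> ennreal" where
  "ext_norm \<alpha> f =
     (SUP s \<in> {s :: complex \<Rightarrow> real. simple_function \<mu>\<^sub>T s \<and>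
                 (AE z in \<mu>\<^sub>T. 0 \<le> s z \<and> s z \<le> cmod (f z))}.
        ennreal (\<alpha> (\<lambda>z. complex_of_real (s z))))"

definition calL :: "((complex \<Rightarrow> complex) \<Rightarrow> real) \<Rightarrow> (complex \<Rightarrow> complex) set" where
  "calL \<alpha> = {f \<in> borel_measurable \<mu>\<^sub>T. ext_norm \<alpha> f < \<infinity>}"

definition Lspace :: "((complex \<Rightarrow> complex) \<Rightarrow> real) \<Rightarrow> (complex \<Rightarrow> complex) set" where
  "Lspace \<alpha> = {f \<in> calL \<alpha>. \<forall>e>0. \<exists>g\<in>Linf. ext_norm \<alpha> (\<lambda>z. f z - g z) < e}"

text \<open>
  For an \<open>L\<^sup>1\<close>-dominating norm the set below is bounded above for every \<open>f\<close> in \<^const>\<open>Linf\<close>, so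
  that the real supremum is the intended one; \<^const>\<open>ext_norm\<close> extends it to measurable functions.
\<close>

definition dual_norm :: "((complex \<Rightarrow> complex) \<Rightarrow> real) \<Rightarrow> (complex \<Rightarrow> complex) \<Rightarrow> real" where
  "dual_norm \<alpha> f = Sup {cmod (\<integral>z. f z * h z \<partial>\<mu>\<^sub>T) | h. h \<in> Linf \<and> \<alpha> h \<le> 1}"

definition weak_topology :: "((complex \<Rightarrow> complex) \<Rightarrow> real) \<Rightarrow> (complex \<Rightarrow> complex) topology" where
  "weak_topology \<alpha> =
     topology_generated_by
       {{f \<in> Lspace \<alpha>. (\<integral>z. f z * g z \<partial>\<mu>\<^sub>T) \<in> U} | g U. g \<in> calL (dual_norm \<alpha>) \<and> open U}"

text \<open>The condition says that all Fourier coefficients of negative index vanish.\<close>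

definition Hinf :: "(complex \<Rightarrow> complex) set" where
  "Hinf = {f \<in> Linf. \<forall>n::nat. n \<ge> 1 \<longrightarrow> (\<integral>z. f z * z ^ n \<partial>\<mu>\<^sub>T) = 0}"

definition Hspace :: "((complex \<Rightarrow> complex) \<Rightarrow> real) \<Rightarrow> (complex \<Rightarrow> complex) set" where
  "Hspace \<alpha> = weak_topology \<alpha> closure_of Hinf"

definition unimodular :: "(complex \<Rightarrow> complex) \<Rightarrow> bool" where
  "unimodular u \<longleftrightarrow> (AE z in \<mu>\<^sub>T. cmod (u z) = 1)"

definition poisson_integral :: "(complex \<Rightarrow> complex) \<Rightarrow> complex \<Rightarrow> complex" where
  "poisson_integral f z =
     (\<integral>w. complex_of_real ((1 - (cmod z)\<^sup>2) / (cmod (w - z))\<^sup>2) * f w \<partial>\<mu>\<^sub>T)"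

text \<open>
  A function \<open>f\<close> in \<^const>\<open>Hinf\<close> is identified with its analytic extension to the unit disc, which is
  the Poisson integral of \<open>f\<close>. It is outer if this extension is
  \<open>\<lambda> exp (\<integral> (w + z)/(w - z) log |f(w)| d\<mu>(w))\<close> with a unimodular constant \<open>\<lambda>\<close>. As
  \<^term>\<open>ln (0::real) = 0\<close> in HOL, integrability of \<open>log |f|\<close> does not by itself say that \<open>f\<close> is
  nonzero a.e., so this is stated separately.
\<close>

definition outer :: "(complex \<Rightarrow> complex) \<Rightarrow> bool" where
  "outer f \<longleftrightarrow>
     f \<in> Hinf \<and> (AE w in \<mu>\<^sub>T. f w \<noteq> 0) \<and> integrable \<mu>\<^sub>T (\<lambda>w. ln (cmod (f w))) \<and>
     (\<exists>l. cmod l = 1 \<and>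
        (\<forall>z\<in>ball 0 1. poisson_integral f z =
           l * exp (\<integral>w. (w + z) / (w - z) * complex_of_real (ln (cmod (f w))) \<partial>\<mu>\<^sub>T)))"

end

theory Submission
  imports Defs "HOL-Complex_Analysis.Complex_Analysis"
begin

text \<open>
  Since \<open>1/k\<close> is integrable, so is \<open>log |k|\<close>. Let \<open>s\<close> and \<open>h\<^sub>n\<close> be the bounded outer functions with
  \<open>|s| = |k|\<close> and \<open>|h\<^sub>n| = min (1/|k|) (exp n)\<close>. The product \<open>s h\<^sub>n\<close> is bounded by \<open>1\<close> and has mean
  \<open>exp (\<integral> log |s h\<^sub>n|)\<close>, which tends to \<open>1\<close>; hence \<open>s h\<^sub>n\<close> tends to \<open>1\<close> in \<open>L\<^sup>2\<close>, and a subsequence of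
  \<open>h\<^sub>n\<close> tends to \<open>1/s\<close> almost everywhere. As \<open>|h\<^sub>n g| \<le> |g/k|\<close>, which is integrable by Hoelder's
  inequality for \<open>\<alpha>\<close> and its dual norm, dominated convergence gives \<open>h\<^sub>n \<rightarrow> 1/s\<close> in the weak topology.

  The boundary function of an outer function is the \<open>L\<^sup>1\<close> limit of its dilates, and its modulus comes
  from the convergence of Poisson integrals in \<open>L\<^sup>1\<close>.
\<close>

subsection \<open>The normalized arc length\<close>

text \<open>Nothing makes \<alpha>(\<open>h n - 1/s\<close>) small: \<alpha> need not be order
  continuous, and dominated convergence speaks of integrals. Pairings with a fixed dual element are
  integrals, hence the weak topology. The truncation at exp n is there because \<open>1/s\<close>
  may be unbounded, while the approximants must lie in \<open>Hinf\<close>.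

  The means tend to 1 itself, not merely to modulus 1, because every outer function is built with
  unimodular constant 1: its value at 0 is the positive number exp of the mean of its logarithm.
  Values at 0 multiply, so these exponents add. A function x with |x| <= 1 and mean near 1 is near 1
  in \<open>L^2\<close>, since |x - 1|^2 = |x|^2 + 1 - 2 Re x <= 2 - 2 Re x.

  Monotonicity of \<alpha> in the modulus is not an axiom; it is derived, and makes the extended
  norm finite on \<open>Linf\<close>. Domination of the \<open>L^1\<close> norm puts the constant 1
  into the dual space, so that integrability of \<open>1/k\<close> is a case of Hoelder's
  inequality. The factor \<open>u\<close> is \<open>k / s\<close>, and \<open>1/s\<close> is in
  \<open>Lspace\<close> as a unimodular multiple of \<open>1/k\<close>.\<close>

lemma space_circle_measure [simp]: "space \<mu>\<^sub>T = sphere 0 1"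
  by (simp add: circle_measure_def space_restrict_space)

lemma sets_circle_measure [measurable_cong]:
  "sets \<mu>\<^sub>T = sets (restrict_space borel (sphere 0 1))"
  by (simp add: circle_measure_def)

lemma borel_measurable_circle_continuous:
  fixes f :: "complex \<Rightarrow> 'b :: topological_space"
  assumes "continuous_on (sphere 0 1) f"
  shows "f \<in> borel_measurable \<mu>\<^sub>T"
  using borel_measurable_continuous_on_restrict[OF assms]
  by (simp cong: measurable_cong_sets add: sets_circle_measure)

lemma measurable_circle_ident [measurable]: "(\<lambda>w. w) \<in> borel_measurable \<mu>\<^sub>T"
  by (rule borel_measurable_circle_continuous) (rule continuous_on_id)

lemma measurable_cis_circle:
  "cis \<in> measurable (uniform_measure lborel {0..2 * pi}) (restrict_space borel (sphere 0 1))"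
proof (rule measurable_restrict_space2)
  show "cis \<in> borel_measurable (uniform_measure lborel {0..2 * pi})"
    by (simp add: borel_measurable_continuous_onI continuous_intros cong: measurable_cong_sets)
qed auto

lemma emeasure_circle [simp]: "emeasure \<mu>\<^sub>T (sphere 0 1) = 1"
proof -
  have "emeasure \<mu>\<^sub>T (sphere 0 1) = emeasure (uniform_measure lborel {0..2 * pi})
      (cis -` sphere 0 1 \<inter> space (uniform_measure lborel {0..2 * pi}))"
    unfolding circle_measure_def
    by (rule emeasure_distr[OF measurable_cis_circle]) (simp add: sets_restrict_space_iff)
  also have "cis -` sphere 0 1 \<inter> space (uniform_measure lborel {0..2 * pi}) = UNIV"
    by auto
  also have "emeasure (uniform_measure lborel {0..2 * pi}) UNIV = 1"
    by (subst emeasure_uniform_measure) (auto simp: ennreal_divide_self)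
  finally show ?thesis .
qed

interpretation circle: finite_measure \<mu>\<^sub>T
  by standard simp

lemma measure_circle [simp]: "measure \<mu>\<^sub>T (sphere 0 1) = 1"
  by (simp add: measure_def)

lemma integrable_circle_continuous:
  fixes f :: "complex \<Rightarrow> 'b :: {banach, second_countable_topology}"
  assumes "continuous_on (sphere 0 1) f"
  shows "integrable \<mu>\<^sub>T f"
proof -
  have "bounded (f ` sphere 0 1)"
    by (intro compact_imp_bounded compact_continuous_image assms) auto
  then obtain B where "\<And>w. w \<in> sphere 0 1 \<Longrightarrow> norm (f w) \<le> B"
    unfolding bounded_iff by blast
  then show ?thesis
    by (intro circle.integrable_const_bound[of _ B] borel_measurable_circle_continuous assms AE_I2) auto
qed

text \<open>This formula in the angle serves to integrate \<open>w ^ n\<close>; later computations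
  on the circle start from the resulting moments.\<close>

lemma integral_circle_eq:
  fixes f :: "complex \<Rightarrow> 'b :: {banach, second_countable_topology}"
  assumes "f \<in> borel_measurable \<mu>\<^sub>T"
  shows "(\<integral>w. f w \<partial>\<mu>\<^sub>T) = (1 / (2 * pi)) *\<^sub>R (\<integral>t. indicator {0..2 * pi} t *\<^sub>R f (cis t) \<partial>lborel)"
proof -
  have f: "f \<in> borel_measurable (restrict_space borel (sphere 0 1))"
    using assms by (simp cong: measurable_cong_sets add: sets_circle_measure)
  have uni: "uniform_measure lborel {0..2 * pi}
      = density lborel (\<lambda>t. ennreal (indicator {0..2 * pi} t / (2 * pi)))"
    unfolding uniform_measure_def
    by (intro density_cong AE_I2) (auto simp: divide_ennreal[of 1, simplified] split: split_indicator)
  have fc: "(\<lambda>t. f (cis t)) \<in> borel_measurable lborel"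
    using measurable_comp[OF measurable_cis_circle f]
    by (simp add: o_def cong: measurable_cong_sets)
  have "(\<integral>w. f w \<partial>\<mu>\<^sub>T) = (\<integral>t. f (cis t) \<partial>uniform_measure lborel {0..2 * pi})"
    unfolding circle_measure_def by (rule integral_distr[OF measurable_cis_circle f])
  also have "\<dots> = (\<integral>t. (indicator {0..2 * pi} t / (2 * pi)) *\<^sub>R f (cis t) \<partial>lborel)"
    unfolding uni by (rule integral_density[OF fc]) auto
  also have "\<dots> = (\<integral>t. (1 / (2 * pi)) *\<^sub>R (indicator {0..2 * pi} t *\<^sub>R f (cis t)) \<partial>lborel)"
    by (simp add: mult.commute)
  finally show ?thesis by (simp only: integral_scaleR_right)
qed

text \<open>The antiderivative cis (n t) / (i n) of cis (n t) takes equal values at 0 and 2 pi; n >=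
  1 keeps its denominator away from 0.\<close>

lemma integral_circle_power:
  assumes "n \<ge> 1"
  shows "(\<integral>w. w ^ n \<partial>\<mu>\<^sub>T) = 0"
proof -
  let ?F = "\<lambda>t. cis (real n * t) / (\<i> * of_nat n)"
  have "(\<integral>t. indicator {0..2 * pi} t *\<^sub>R (cis t ^ n) \<partial>lborel) = ?F (2 * pi) - ?F 0"
  proof (rule integral_FTC_Icc)
    fix t :: real
    have "((\<lambda>t. exp (\<i> * of_real (real n * t)) / (\<i> * of_nat n)) has_vector_derivative
             exp (\<i> * of_real (real n * t))) (at t within {0..2 * pi})"
      using assms by (auto intro!: derivative_eq_intros has_vector_derivative_real_field simp: field_simps)
    then show "(?F has_vector_derivative cis t ^ n) (at t within {0..2 * pi})"
      by (simp only: Complex.DeMoivre) (simp only: cis_conv_exp)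
  qed (auto intro!: continuous_intros)
  also have "\<dots> = 0"
    using cis_multiple_2pi[of "real n"] by (simp add: mult.commute mult.left_commute)
  finally show ?thesis
    by (subst integral_circle_eq) (auto intro!: borel_measurable_circle_continuous continuous_intros)
qed

section \<open>Orthogonality of the powers and termwise integration\<close>

lemma circle_cnj_mult: "w \<in> sphere 0 1 \<Longrightarrow> w * cnj w = 1"
  using complex_norm_square[of w] by simp

text \<open>On the circle \<open>cnj w\<close> is the inverse of \<open>w\<close>, so the smaller
  power cancels and a pure power of \<open>w\<close> or of its conjugate remains.\<close>

lemma integral_circle_moments:
  "(\<integral>w. w ^ m * cnj w ^ n \<partial>\<mu>\<^sub>T) = (if m = n then 1 else 0)"
proof (rule linorder_cases[of m n])
  assume "m = n"
  then have "(\<integral>w. w ^ m * cnj w ^ n \<partial>\<mu>\<^sub>T) = (\<integral>w. 1 \<partial>\<mu>\<^sub>T)"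
    by (intro Bochner_Integration.integral_cong refl)
       (simp add: circle_cnj_mult flip: power_mult_distrib)
  then show ?thesis using \<open>m = n\<close> by simp
next
  assume "m < n"
  then obtain d where d: "n = m + d" "d \<ge> 1" by (metis less_imp_add_positive Suc_leI One_nat_def)
  have "(\<integral>w. w ^ m * cnj w ^ n \<partial>\<mu>\<^sub>T) = (\<integral>w. cnj (w ^ d) \<partial>\<mu>\<^sub>T)"
  proof (intro Bochner_Integration.integral_cong refl)
    fix w assume "w \<in> space \<mu>\<^sub>T"
    have "w ^ m * cnj w ^ n = (w * cnj w) ^ m * cnj w ^ d"
      by (simp add: d power_add power_mult_distrib)
    then show "w ^ m * cnj w ^ n = cnj (w ^ d)"
      using \<open>w \<in> space \<mu>\<^sub>T\<close> by (simp add: circle_cnj_mult)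
  qed
  also have "\<dots> = cnj (\<integral>w. w ^ d \<partial>\<mu>\<^sub>T)"
    by (rule Bochner_Integration.integral_cnj)
  finally show ?thesis using \<open>m < n\<close> integral_circle_power[OF d(2)] by simp
next
  assume "n < m"
  then obtain d where d: "m = n + d" "d \<ge> 1" by (metis less_imp_add_positive Suc_leI One_nat_def)
  have "(\<integral>w. w ^ m * cnj w ^ n \<partial>\<mu>\<^sub>T) = (\<integral>w. w ^ d \<partial>\<mu>\<^sub>T)"
  proof (intro Bochner_Integration.integral_cong refl)
    fix w assume "w \<in> space \<mu>\<^sub>T"
    have "w ^ m * cnj w ^ n = (w * cnj w) ^ n * w ^ d"
      by (simp add: d power_add power_mult_distrib)
    then show "w ^ m * cnj w ^ n = w ^ d"
      using \<open>w \<in> space \<mu>\<^sub>T\<close> by (simp add: circle_cnj_mult)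
  qed
  then show ?thesis using \<open>n < m\<close> integral_circle_power[OF d(2)] by simp
qed

lemma integrable_circle_mult_bounded:
  fixes \<phi> f :: "complex \<Rightarrow> complex"
  assumes "integrable \<mu>\<^sub>T \<phi>" "f \<in> borel_measurable \<mu>\<^sub>T" "AE w in \<mu>\<^sub>T. cmod (f w) \<le> B"
  shows "integrable \<mu>\<^sub>T (\<lambda>w. \<phi> w * f w)"
proof (rule Bochner_Integration.integrable_bound)
  show "integrable \<mu>\<^sub>T (\<lambda>w. B * cmod (\<phi> w))" using assms(1) by simp
  show "AE w in \<mu>\<^sub>T. cmod (\<phi> w * f w) \<le> norm (B * cmod (\<phi> w))"
    using assms(3)
  proof eventually_elim
    case (elim w)
    then have "cmod (\<phi> w * f w) \<le> cmod (\<phi> w) * B"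
      by (simp add: norm_mult mult_left_mono)
    then show ?case by (simp add: mult.commute)
  qed
qed (use assms in measurable)

text \<open>Absolutely summable coefficients against functions bounded by 1 leave a multiple of the
  modulus of \<phi> as majorant, so sum and integral commute. The \<open>e n\<close> are abstract
  because they are powers of \<open>w\<close> in some uses and of \<open>cnj w\<close> in others;
  the series concerned are those of the Poisson kernel, of the Herglotz kernel and of dilated
  holomorphic functions.\<close>

lemma sums_integral_circle_series:
  fixes \<phi> :: "complex \<Rightarrow> complex" and e :: "nat \<Rightarrow> complex \<Rightarrow> complex"
  assumes \<phi>: "integrable \<mu>\<^sub>T \<phi>" and c: "summable (\<lambda>n. cmod (c n))"
    and e: "\<And>n. e n \<in> borel_measurable \<mu>\<^sub>T" "\<And>n w. w \<in> sphere 0 1 \<Longrightarrow> cmod (e n w) \<le> 1"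
    and f: "\<And>w. w \<in> sphere 0 1 \<Longrightarrow> (\<lambda>n. c n * e n w) sums f w"
  shows "(\<lambda>n. c n * (\<integral>w. \<phi> w * e n w \<partial>\<mu>\<^sub>T)) sums (\<integral>w. \<phi> w * f w \<partial>\<mu>\<^sub>T)"
proof -
  let ?g = "\<lambda>n w. c n * (\<phi> w * e n w)"
  have int: "integrable \<mu>\<^sub>T (\<lambda>w. \<phi> w * e n w)" for n
    by (rule integrable_circle_mult_bounded[OF \<phi> e(1), of _ 1]) (use e(2) in auto)
  have bd: "cmod (?g n w) \<le> cmod (c n) * cmod (\<phi> w)" if "w \<in> sphere 0 1" for n w
    using e(2)[OF that, of n] by (simp add: norm_mult mult_left_mono mult_left_le)
  have "(\<lambda>n. integral\<^sup>L \<mu>\<^sub>T (?g n)) sums (\<integral>w. (\<Sum>n. ?g n w) \<partial>\<mu>\<^sub>T)"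
  proof (rule sums_integral)
    show "integrable \<mu>\<^sub>T (?g n)" for n using int by simp
    show "AE w in \<mu>\<^sub>T. summable (\<lambda>n. norm (?g n w))"
    proof (intro AE_I2)
      fix w assume "w \<in> space \<mu>\<^sub>T"
      then have "norm (norm (?g n w)) \<le> cmod (c n) * cmod (\<phi> w)" for n
        using bd by simp
      then show "summable (\<lambda>n. norm (?g n w))"
        by (rule summable_comparison_test'[OF summable_mult2[OF c]])
    qed
    show "summable (\<lambda>n. \<integral>w. norm (?g n w) \<partial>\<mu>\<^sub>T)"
    proof (rule summable_comparison_test'[of _ 0])
      show "summable (\<lambda>n. cmod (c n) * (\<integral>w. cmod (\<phi> w) \<partial>\<mu>\<^sub>T))" by (rule summable_mult2[OF c])
      have "(\<integral>w. norm (?g n w) \<partial>\<mu>\<^sub>T) \<le> (\<integral>w. cmod (c n) * cmod (\<phi> w) \<partial>\<mu>\<^sub>T)" for n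
        using bd int \<phi> by (intro integral_mono integrable_norm integrable_mult_right) (auto simp only: space_circle_measure)
      then show "norm (\<integral>w. norm (?g n w) \<partial>\<mu>\<^sub>T) \<le> cmod (c n) * (\<integral>w. cmod (\<phi> w) \<partial>\<mu>\<^sub>T)" for n
        by simp
    qed
  qed
  moreover have "(\<integral>w. (\<Sum>n. ?g n w) \<partial>\<mu>\<^sub>T) = (\<integral>w. \<phi> w * f w \<partial>\<mu>\<^sub>T)"
  proof (intro Bochner_Integration.integral_cong refl)
    fix w assume "w \<in> space \<mu>\<^sub>T"
    then have "(\<lambda>n. \<phi> w * (c n * e n w)) sums (\<phi> w * f w)" by (intro sums_mult f) simp
    then show "(\<Sum>n. ?g n w) = \<phi> w * f w" by (simp add: sums_iff mult_ac)
  qed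
  ultimately show ?thesis by simp
qed

subsection \<open>Poisson integrals\<close>

text \<open>The kernel of \<open>poisson_integral\<close>, kept real-valued so that it also acts on
  real functions and can be estimated by order.\<close>

definition poisson_kernel :: "complex \<Rightarrow> complex \<Rightarrow> real" where
  "poisson_kernel z w = (1 - (cmod z)\<^sup>2) / (cmod (w - z))\<^sup>2"

lemma poisson_kernel_nonneg: "cmod z \<le> 1 \<Longrightarrow> 0 \<le> poisson_kernel z w"
  by (simp add: poisson_kernel_def abs_square_le_1)

lemma sphere_neq_ball: "w \<in> sphere 0 1 \<Longrightarrow> cmod z < 1 \<Longrightarrow> w \<noteq> z"
  by auto

lemma continuous_on_poisson_kernel:
  "cmod z < 1 \<Longrightarrow> continuous_on (sphere 0 1) (poisson_kernel z)"
  unfolding poisson_kernel_def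
  by (intro continuous_intros) (auto dest: sphere_neq_ball)

text \<open>The first form is a geometric series in \<open>cnj w\<close> plus one in
  \<open>w\<close> without constant term, ready for termwise integration. The second identifies the
  kernel as the real part of the Herglotz kernel and later gives the modulus of an outer
  function.\<close>

lemma poisson_kernel_eq:
  assumes "w \<in> sphere 0 1" "cmod z < 1"
  shows "complex_of_real (poisson_kernel z w) = 1 / (1 - z * cnj w) + cnj z * w / (1 - cnj z * w)"
    and "poisson_kernel z w = Re ((w + z) / (w - z))"
proof -
  have w: "w * cnj w = 1" by (rule circle_cnj_mult[OF assms(1)])
  have ne: "w - z \<noteq> 0" "cnj w - cnj z \<noteq> 0"
    using sphere_neq_ball[OF assms] by (auto simp flip: complex_cnj_diff)
  have "1 - z * cnj w = cnj w * (w - z)" "1 - cnj z * w = w * (cnj w - cnj z)"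
    using w by (auto simp: algebra_simps)
  moreover have "w \<noteq> 0" "cnj w \<noteq> 0" using assms by auto
  moreover have "1 / cnj w = w"
    using w \<open>cnj w \<noteq> 0\<close> by (simp add: divide_simps)
  ultimately have "1 / (1 - z * cnj w) + cnj z * w / (1 - cnj z * w)
      = w / (w - z) + cnj z / (cnj w - cnj z)"
    using ne by (metis (no_types, lifting) divide_divide_eq_left mult.commute mult_divide_mult_cancel_left)
  also have "\<dots> = (w * (cnj w - cnj z) + cnj z * (w - z)) / ((w - z) * (cnj w - cnj z))"
    using ne by (simp add: divide_simps)
  also have "w * (cnj w - cnj z) + cnj z * (w - z) = w * cnj w - z * cnj z"
    by (simp add: algebra_simps)
  also have "\<dots> = complex_of_real (1 - (cmod z)\<^sup>2)"
    unfolding w using complex_norm_square[of z] by simp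
  also have "(w - z) * (cnj w - cnj z) = complex_of_real ((cmod (w - z))\<^sup>2)"
    using complex_norm_square[of "w - z"] by simp
  finally show "complex_of_real (poisson_kernel z w) = 1 / (1 - z * cnj w) + cnj z * w / (1 - cnj z * w)"
    by (simp add: poisson_kernel_def)
  have "(w + z) / (w - z) = (w + z) * cnj (w - z) / complex_of_real ((cmod (w - z))\<^sup>2)"
    using ne complex_norm_square[of "w - z"] by (simp add: divide_simps mult.commute)
  then have "Re ((w + z) / (w - z)) = Re ((w + z) * cnj (w - z)) / (cmod (w - z))\<^sup>2"
    by (simp only: Re_divide_of_real)
  also have "Re ((w + z) * cnj (w - z)) = (cmod w)\<^sup>2 - (cmod z)\<^sup>2"
    unfolding cmod_power2 by (simp add: algebra_simps power2_eq_square)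
  finally show "poisson_kernel z w = Re ((w + z) / (w - z))"
    using assms by (simp add: poisson_kernel_def)
qed

text \<open>Of the series in \<open>cnj w\<close> only the term n = m survives, with coefficient
  \<open>z ^ m\<close>; the series in \<open>w\<close> meets only the powers m + n + 1 >= 1, whose
  integrals vanish. The case m = 0 gives the total mass of the kernel.\<close>

lemma poisson_kernel_power:
  assumes "cmod z < 1"
  shows "(\<integral>w. complex_of_real (poisson_kernel z w) * w ^ m \<partial>\<mu>\<^sub>T) = z ^ m"
proof -
  have su: "summable (\<lambda>n. cmod (z ^ n))" "summable (\<lambda>n. cmod (cnj z ^ Suc n))"
    using assms by (simp_all add: norm_power norm_mult)
  have pw: "integrable \<mu>\<^sub>T (\<lambda>w. w ^ m)"
    by (intro integrable_circle_continuous continuous_intros)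
  have 1: "(\<lambda>n. z ^ n * (\<integral>w. w ^ m * cnj w ^ n \<partial>\<mu>\<^sub>T)) sums (\<integral>w. w ^ m * (1 / (1 - z * cnj w)) \<partial>\<mu>\<^sub>T)"
  proof (rule sums_integral_circle_series[OF pw su(1)])
    fix w :: complex assume "w \<in> sphere 0 1"
    then have "(\<lambda>n. (z * cnj w) ^ n) sums (1 / (1 - z * cnj w))"
      using assms by (intro geometric_sums) (simp add: norm_mult)
    then show "(\<lambda>n. z ^ n * cnj w ^ n) sums (1 / (1 - z * cnj w))"
      by (simp add: power_mult_distrib)
  qed (auto simp: norm_power intro!: borel_measurable_circle_continuous continuous_intros)
  have "(\<lambda>n. z ^ n * (\<integral>w. w ^ m * cnj w ^ n \<partial>\<mu>\<^sub>T)) = (\<lambda>n. if n = m then z ^ m else 0)"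
    by (auto simp: integral_circle_moments)
  then have "(\<lambda>n. z ^ n * (\<integral>w. w ^ m * cnj w ^ n \<partial>\<mu>\<^sub>T)) sums z ^ m"
    using sums_single[of m "\<lambda>_. z ^ m"] by (simp add: fun_eq_iff)
  then have 1: "(\<integral>w. w ^ m * (1 / (1 - z * cnj w)) \<partial>\<mu>\<^sub>T) = z ^ m"
    using 1 sums_unique2 by blast
  have 2: "(\<lambda>n. cnj z ^ Suc n * (\<integral>w. w ^ m * w ^ Suc n \<partial>\<mu>\<^sub>T)) sums (\<integral>w. w ^ m * (cnj z * w / (1 - cnj z * w)) \<partial>\<mu>\<^sub>T)"
  proof (rule sums_integral_circle_series[OF pw su(2)])
    fix w :: complex assume "w \<in> sphere 0 1"
    then have "(\<lambda>n. (cnj z * w) ^ n) sums (1 / (1 - cnj z * w))"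
      using assms by (intro geometric_sums) (simp add: norm_mult)
    then have "(\<lambda>n. cnj z * w * (cnj z * w) ^ n) sums (cnj z * w * (1 / (1 - cnj z * w)))"
      by (rule sums_mult)
    then show "(\<lambda>n. cnj z ^ Suc n * w ^ Suc n) sums (cnj z * w / (1 - cnj z * w))"
      by (simp add: power_mult_distrib mult_ac)
  qed (auto simp: norm_power norm_mult intro!: borel_measurable_circle_continuous continuous_intros)
  have "(\<integral>w. w ^ m * w ^ Suc n \<partial>\<mu>\<^sub>T) = 0" for n
    using integral_circle_power[of "m + Suc n"] by (simp only: power_add[symmetric])
  then have 2: "(\<integral>w. w ^ m * (cnj z * w / (1 - cnj z * w)) \<partial>\<mu>\<^sub>T) = 0"
    using 2 by (simp add: sums_iff del: power_Suc)
  have ne: "1 - z * cnj w \<noteq> 0" "1 - cnj z * w \<noteq> 0" if "w \<in> sphere 0 1" for w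
  proof -
    have "cmod (z * cnj w) < 1" "cmod (cnj z * w) < 1"
      using that assms by (simp_all add: norm_mult)
    then show "1 - z * cnj w \<noteq> 0" "1 - cnj z * w \<noteq> 0" by force+
  qed
  have "(\<integral>w. complex_of_real (poisson_kernel z w) * w ^ m \<partial>\<mu>\<^sub>T)
      = (\<integral>w. w ^ m * (1 / (1 - z * cnj w)) + w ^ m * (cnj z * w / (1 - cnj z * w)) \<partial>\<mu>\<^sub>T)"
    using assms by (intro Bochner_Integration.integral_cong refl) (simp add: poisson_kernel_eq(1) algebra_simps)
  also have "\<dots> = z ^ m + 0"
    unfolding 1[symmetric] 2[symmetric]
    by (intro Bochner_Integration.integral_add integrable_circle_continuous continuous_intros)
       (use ne in auto)
  finally show ?thesis by simp
qed

lemma integral_poisson_kernel: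
  assumes "cmod z < 1"
  shows "(\<integral>w. poisson_kernel z w \<partial>\<mu>\<^sub>T) = 1"
  using poisson_kernel_power[OF assms, of 0] by simp

section \<open>Density of the continuous functions in \<open>L^1\<close>\<close>

lemma integrable_circle_continuous_UNIV:
  fixes g :: "complex \<Rightarrow> 'b :: {banach, second_countable_topology}"
  assumes "continuous_on UNIV g"
  shows "integrable \<mu>\<^sub>T g"
  by (rule integrable_circle_continuous) (rule continuous_on_subset[OF assms], simp)

text \<open>For an indicator, regularity squeezes the set between a compact \<open>K\<close> and an
  open \<open>U\<close> of nearly the same measure, and a Urysohn function differs from the
  indicator only on \<open>U - K\<close>. Sums and dominated limits follow by the induction
  principle for integrable functions.\<close>

lemma circle_continuous_dense:
  fixes f :: "complex \<Rightarrow> real"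
  assumes "integrable \<mu>\<^sub>T f" "\<epsilon> > 0"
  shows "\<exists>g. continuous_on UNIV g \<and> (\<integral>w. \<bar>f w - g w\<bar> \<partial>\<mu>\<^sub>T) < \<epsilon>"
  using assms
proof (induction arbitrary: \<epsilon> rule: integrable_induct)
  case (base A c)
  \<comment> \<open>Regularity is a statement about Borel measures on the whole plane, so the circle
    measure is pushed forward along the inclusion.\<close>
  let ?N = "distr \<mu>\<^sub>T borel (\<lambda>w. w)"
  have N: "emeasure ?N X = emeasure \<mu>\<^sub>T (X \<inter> sphere 0 1)" if "X \<in> sets borel" for X
    using that by (subst emeasure_distr) auto
  obtain B where B: "B \<in> sets borel" "A = B \<inter> sphere 0 1"
    using base(1) by (auto simp: sets_circle_measure sets_restrict_space)
  \<comment> \<open>The summand 1 keeps the denominator positive when c = 0; the error 2 e |c|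
    obtained below stays under the given bound in every case.\<close>
  define e where "e = \<epsilon> / (2 * (\<bar>c\<bar> + 1))"
  have e: "e > 0" "2 * e * \<bar>c\<bar> < \<epsilon>"
    using \<open>\<epsilon> > 0\<close> by (auto simp: e_def field_simps)
  have fin: "emeasure ?N (space ?N) \<noteq> \<infinity>" "emeasure ?N B \<noteq> \<infinity>"
    by (simp_all add: N B(1))
  \<comment> \<open>Finiteness makes this inequality strict, so that \<open>K\<close> and
    \<open>U\<close> can be picked from the supremum and the infimum.\<close>
  have Nf: "emeasure ?N B < emeasure ?N B + ennreal e"
    using fin(2) e by (simp add: ennreal_add_left_cancel_less)
  have "emeasure ?N B < (SUP K \<in> {K. K \<subseteq> B \<and> compact K}. emeasure ?N K) + ennreal e"
    using Nf inner_regular[OF _ fin(1) B(1)] by simp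
  then have "emeasure ?N B < (SUP K \<in> {K. K \<subseteq> B \<and> compact K}. emeasure ?N K + ennreal e)"
    by (subst (asm) ennreal_SUP_add_left[symmetric]) (auto intro!: exI[of _ "{}"])
  then obtain K where K: "K \<subseteq> B" "compact K" "emeasure ?N B < emeasure ?N K + ennreal e"
    by (auto simp: less_SUP_iff)
  have "(INF U \<in> {U. B \<subseteq> U \<and> open U}. emeasure ?N U) < emeasure ?N B + ennreal e"
    using Nf outer_regular[OF _ fin(1) B(1)] by simp
  then obtain U where U: "B \<subseteq> U" "open U" "emeasure ?N U < emeasure ?N B + ennreal e"
    by (auto simp: INF_less_iff)
  have [measurable]: "K \<in> sets borel" "U \<in> sets borel"
    using K U by (auto intro: borel_compact)
  have less: "measure \<mu>\<^sub>T (X \<inter> sphere 0 1) < measure \<mu>\<^sub>T (Y \<inter> sphere 0 1) + e"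
    if "emeasure ?N X < emeasure ?N Y + ennreal e" "X \<in> sets borel" "Y \<in> sets borel" for X Y
    using that(1) e(1)
    unfolding N[OF that(2)] N[OF that(3)] circle.emeasure_eq_measure
    by (simp add: ennreal_less_iff flip: ennreal_plus)
  have "measure \<mu>\<^sub>T (B \<inter> sphere 0 1) < measure \<mu>\<^sub>T (K \<inter> sphere 0 1) + e"
    "measure \<mu>\<^sub>T (U \<inter> sphere 0 1) < measure \<mu>\<^sub>T (B \<inter> sphere 0 1) + e"
    by (intro less K(3) U(3) B(1); measurable)+
  moreover have sets: "K \<inter> sphere 0 1 \<in> sets \<mu>\<^sub>T" "U \<inter> sphere 0 1 \<in> sets \<mu>\<^sub>T"
    by (auto simp: sets_circle_measure sets_restrict_space)
  ultimately have meas: "measure \<mu>\<^sub>T (U \<inter> sphere 0 1 - K \<inter> sphere 0 1) < 2 * e"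
    using K(1) U(1) by (subst circle.finite_measure_Diff) auto
  obtain g :: "complex \<Rightarrow> real" where g: "continuous_on UNIV g" "\<And>x. g x \<in> closed_segment 1 0"
      "\<And>x. x \<in> K \<Longrightarrow> g x = 1" "\<And>x. x \<in> - U \<Longrightarrow> g x = 0"
  proof (rule Urysohn[of K "- U" 1 0])
    show "closed K" "closed (- U)" using K(2) U(2) by (auto simp: compact_imp_closed)
    show "K \<inter> - U = {}" using K(1) U(1) by auto
  qed auto
  have "(\<integral>w. \<bar>indicator A w *\<^sub>R c - c * g w\<bar> \<partial>\<mu>\<^sub>T)
      \<le> (\<integral>w. \<bar>c\<bar> * indicator (U \<inter> sphere 0 1 - K \<inter> sphere 0 1) w \<partial>\<mu>\<^sub>T)"
  proof (rule integral_mono)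
    show "integrable \<mu>\<^sub>T (\<lambda>w. \<bar>indicator A w *\<^sub>R c - c * g w\<bar>)"
    proof (intro integrable_abs Bochner_Integration.integrable_diff integrable_mult_right)
      show "integrable \<mu>\<^sub>T (\<lambda>w. indicator A w *\<^sub>R c)"
        using base(1) by (simp add: circle.emeasure_eq_measure)
      show "integrable \<mu>\<^sub>T g"
        by (rule integrable_circle_continuous_UNIV[OF g(1)])
    qed
    show "\<bar>indicator A w *\<^sub>R c - c * g w\<bar> \<le> \<bar>c\<bar> * indicator (U \<inter> sphere 0 1 - K \<inter> sphere 0 1) w"
      if "w \<in> space \<mu>\<^sub>T" for w
    proof -
      have eq: "\<bar>indicator A w *\<^sub>R c - c * g w\<bar> = \<bar>c\<bar> * \<bar>indicator A w - g w\<bar>"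
        by (simp flip: abs_mult add: algebra_simps)
      have "0 \<le> g w" "g w \<le> 1" using g(2)[of w] by (auto simp: closed_segment_eq_real_ivl)
      then have "\<bar>indicator A w - g w\<bar> \<le> indicator (U \<inter> sphere 0 1 - K \<inter> sphere 0 1) w"
        using that g(3)[of w] g(4)[of w] B(2) K(1) U(1) by (auto split: split_indicator)
      then show ?thesis unfolding eq by (rule mult_left_mono) simp
    qed
  qed (use sets in \<open>auto simp: circle.emeasure_eq_measure\<close>)
  also have "\<dots> = \<bar>c\<bar> * measure \<mu>\<^sub>T (U \<inter> sphere 0 1 - K \<inter> sphere 0 1)"
    using sets by (simp add: Int_absorb2 Diff_subset subset_eq)
  also have "\<dots> \<le> 2 * e * \<bar>c\<bar>"
    using mult_right_mono[OF less_imp_le[OF meas], of "\<bar>c\<bar>"] by (simp add: mult.commute)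
  also have "\<dots> < \<epsilon>" by (rule e)
  finally show ?case
    using g(1) by (intro exI[of _ "\<lambda>w. c * g w"]) (auto intro!: continuous_intros)
next
  case (add f h)
  obtain g g' where g: "continuous_on UNIV g" "(\<integral>w. \<bar>f w - g w\<bar> \<partial>\<mu>\<^sub>T) < \<epsilon> / 2"
      "continuous_on UNIV g'" "(\<integral>w. \<bar>h w - g' w\<bar> \<partial>\<mu>\<^sub>T) < \<epsilon> / 2"
    using add.IH[of "\<epsilon> / 2"] add.prems by auto
  have int: "integrable \<mu>\<^sub>T (\<lambda>w. \<bar>f w - g w\<bar>)" "integrable \<mu>\<^sub>T (\<lambda>w. \<bar>h w - g' w\<bar>)"
     "integrable \<mu>\<^sub>T g" "integrable \<mu>\<^sub>T g'"
    using add.hyps g by (simp_all add: integrable_circle_continuous_UNIV)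
  have "(\<integral>w. \<bar>f w + h w - (g w + g' w)\<bar> \<partial>\<mu>\<^sub>T) \<le> (\<integral>w. \<bar>f w - g w\<bar> + \<bar>h w - g' w\<bar> \<partial>\<mu>\<^sub>T)"
    using add.hyps int by (intro integral_mono) auto
  also have "\<dots> < \<epsilon>" using int g by simp
  finally show ?case
    using g by (intro exI[of _ "\<lambda>w. g w + g' w"]) (auto intro!: continuous_intros)
next
  case (lim f s)
  \<comment> \<open>The induction principle supplies approximants with |s i| <= 2 |f|, so the
    difference is at most 3 |f|.\<close>
  have "(\<lambda>i. \<integral>w. \<bar>f w - s i w\<bar> \<partial>\<mu>\<^sub>T) \<longlonglongrightarrow> (\<integral>w. 0 \<partial>\<mu>\<^sub>T)"
  proof (rule integral_dominated_convergence[where w = "\<lambda>w. 3 * \<bar>f w\<bar>"])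
    show "AE w in \<mu>\<^sub>T. (\<lambda>i. \<bar>f w - s i w\<bar>) \<longlonglongrightarrow> 0"
    proof (rule AE_I2)
      fix w assume "w \<in> space \<mu>\<^sub>T"
      then have "(\<lambda>i. \<bar>f w - s i w\<bar>) \<longlonglongrightarrow> \<bar>f w - f w\<bar>"
        by (intro tendsto_intros lim.hyps(2))
      then show "(\<lambda>i. \<bar>f w - s i w\<bar>) \<longlonglongrightarrow> 0" by simp
    qed
    show "AE w in \<mu>\<^sub>T. norm \<bar>f w - s i w\<bar> \<le> 3 * \<bar>f w\<bar>" for i
    proof (rule AE_I2)
      fix w assume "w \<in> space \<mu>\<^sub>T"
      then show "norm \<bar>f w - s i w\<bar> \<le> 3 * \<bar>f w\<bar>" using lim.hyps(3)[of w i] by auto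
    qed
  qed (use lim.hyps in auto)
  then have "\<forall>\<^sub>F i in sequentially. (\<integral>w. \<bar>f w - s i w\<bar> \<partial>\<mu>\<^sub>T) < \<epsilon> / 2"
    using \<open>\<epsilon> > 0\<close> by (intro order_tendstoD(2)[of _ 0]) auto
  then obtain i where i: "(\<integral>w. \<bar>f w - s i w\<bar> \<partial>\<mu>\<^sub>T) < \<epsilon> / 2"
    by (auto simp: eventually_sequentially)
  obtain g where g: "continuous_on UNIV g" "(\<integral>w. \<bar>s i w - g w\<bar> \<partial>\<mu>\<^sub>T) < \<epsilon> / 2"
    using lim.IH[of "\<epsilon> / 2" i] \<open>\<epsilon> > 0\<close> by auto
  have int: "integrable \<mu>\<^sub>T (\<lambda>w. \<bar>f w - s i w\<bar>)" "integrable \<mu>\<^sub>T (\<lambda>w. \<bar>s i w - g w\<bar>)" "integrable \<mu>\<^sub>T g"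
    using lim.hyps(1,4) g by (simp_all add: integrable_circle_continuous_UNIV)
  have "(\<integral>w. \<bar>f w - g w\<bar> \<partial>\<mu>\<^sub>T) \<le> (\<integral>w. \<bar>f w - s i w\<bar> + \<bar>s i w - g w\<bar> \<partial>\<mu>\<^sub>T)"
    using lim.hyps(4) int by (intro integral_mono) auto
  also have "\<dots> < \<epsilon>" using int g i by simp
  finally show ?case using g by blast
qed

section \<open>Convergence of Poisson integrals in \<open>L^1\<close>\<close>

lemma poisson_kernel_bound:
  assumes "w \<in> sphere 0 1" "cmod z < 1"
  shows "poisson_kernel z w \<le> (1 - (cmod z)\<^sup>2) / (1 - cmod z)\<^sup>2"
proof -
  have "1 - cmod z \<le> cmod (w - z)"
    using norm_triangle_ineq2[of w z] assms by simp
  then have "(1 - cmod z)\<^sup>2 \<le> (cmod (w - z))\<^sup>2"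
    using assms by (intro power_mono) auto
  then show ?thesis
    unfolding poisson_kernel_def using assms
    by (intro divide_left_mono) (auto simp: abs_square_le_1 zero_less_mult_iff dest: sphere_neq_ball)
qed

text \<open>Both squared distances equal 1 + r^2 - 2 r Re (w cnj v). Hence the kernel also has mass
  1 when integrated over the direction \<open>v\<close> of its base point.\<close>

lemma poisson_kernel_swap:
  assumes "v \<in> sphere 0 1" "w \<in> sphere 0 1"
  shows "poisson_kernel (of_real r * v) w = poisson_kernel (of_real r * w) v"
proof -
  have "(cmod (w - of_real r * v))\<^sup>2 = (cmod (v - of_real r * w))\<^sup>2"
  proof -
    have "(Re v)\<^sup>2 + (Im v)\<^sup>2 = 1" "(Re w)\<^sup>2 + (Im w)\<^sup>2 = 1"
      using assms by (simp_all flip: cmod_power2)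
    then show ?thesis unfolding cmod_power2 by simp algebra
  qed
  then show ?thesis
    using assms by (simp add: poisson_kernel_def norm_mult)
qed

lemma integrable_poisson_kernel_mult:
  fixes h :: "complex \<Rightarrow> real"
  assumes "integrable \<mu>\<^sub>T h" "cmod z < 1"
  shows "integrable \<mu>\<^sub>T (\<lambda>w. poisson_kernel z w * h w)"
proof (rule Bochner_Integration.integrable_bound)
  let ?B = "(1 - (cmod z)\<^sup>2) / (1 - cmod z)\<^sup>2"
  show "integrable \<mu>\<^sub>T (\<lambda>w. ?B * h w)" using assms by simp
  show "AE w in \<mu>\<^sub>T. norm (poisson_kernel z w * h w) \<le> norm (?B * h w)"
  proof (rule AE_I2)
    fix w assume "w \<in> space \<mu>\<^sub>T"
    then have "poisson_kernel z w \<le> ?B" "0 \<le> poisson_kernel z w"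
      using poisson_kernel_bound[of w z] poisson_kernel_nonneg[of z w] assms(2) by auto
    then have "\<bar>poisson_kernel z w\<bar> \<le> \<bar>?B\<bar>" by linarith
    then show "norm (poisson_kernel z w * h w) \<le> norm (?B * h w)"
      by (simp only: real_norm_def abs_mult mult_right_mono abs_ge_zero)
  qed
  show "(\<lambda>w. poisson_kernel z w * h w) \<in> borel_measurable \<mu>\<^sub>T"
    using borel_measurable_circle_continuous[OF continuous_on_poisson_kernel[OF assms(2)]] assms(1)
    by measurable
qed

lemma measurable_poisson_pair [measurable]:
  "(\<lambda>(v, w). poisson_kernel (of_real r * v) w) \<in> borel_measurable (\<mu>\<^sub>T \<Otimes>\<^sub>M \<mu>\<^sub>T)"
  unfolding poisson_kernel_def split_def by measurable

text \<open>After Tonelli and \<open>poisson_kernel_swap\<close> the inner integral over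
  \<open>v\<close> is the mass of a Poisson kernel, which is 1. The bound does not depend on
  \<open>r\<close>, as the density argument requires.\<close>

lemma poisson_L1_contraction:
  fixes h :: "complex \<Rightarrow> real"
  assumes h: "integrable \<mu>\<^sub>T h" and r: "0 \<le> r" "r < 1"
  shows "integrable \<mu>\<^sub>T (\<lambda>v. \<integral>w. poisson_kernel (of_real r * v) w * h w \<partial>\<mu>\<^sub>T)"
    and "(\<integral>v. \<bar>\<integral>w. poisson_kernel (of_real r * v) w * h w \<partial>\<mu>\<^sub>T\<bar> \<partial>\<mu>\<^sub>T) \<le> (\<integral>w. \<bar>h w\<bar> \<partial>\<mu>\<^sub>T)"
proof -
  interpret P: pair_sigma_finite \<mu>\<^sub>T \<mu>\<^sub>T ..
  let ?K = "\<lambda>v. poisson_kernel (of_real r * v)"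
  let ?H = "\<lambda>v. \<integral>w. ?K v w * h w \<partial>\<mu>\<^sub>T"
  have [measurable]: "h \<in> borel_measurable \<mu>\<^sub>T" using h by simp
  have sm: "cmod (of_real r * v) < 1" if "v \<in> sphere 0 1" for v
    using that r by (simp add: norm_mult)
  have meas: "?H \<in> borel_measurable \<mu>\<^sub>T"
    by (rule circle.borel_measurable_lebesgue_integral) measurable
  have "(\<integral>\<^sup>+v. norm (?H v) \<partial>\<mu>\<^sub>T) \<le> (\<integral>\<^sup>+v. \<integral>\<^sup>+w. norm (?K v w * h w) \<partial>\<mu>\<^sub>T \<partial>\<mu>\<^sub>T)"
    by (intro nn_integral_mono integral_norm_bound_ennreal integrable_poisson_kernel_mult h sm) auto
  also have "\<dots> = (\<integral>\<^sup>+w. \<integral>\<^sup>+v. norm (?K v w * h w) \<partial>\<mu>\<^sub>T \<partial>\<mu>\<^sub>T)"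
    by (rule P.Fubini'[symmetric]) measurable
  also have "\<dots> = (\<integral>\<^sup>+w. norm (h w) \<partial>\<mu>\<^sub>T)"
  proof (intro nn_integral_cong)
    fix w assume w: "w \<in> space \<mu>\<^sub>T"
    have "(\<integral>\<^sup>+v. norm (?K v w * h w) \<partial>\<mu>\<^sub>T) = (\<integral>\<^sup>+v. ennreal \<bar>h w\<bar> * ennreal (?K w v) \<partial>\<mu>\<^sub>T)"
    proof (intro nn_integral_cong)
      fix v assume v: "v \<in> space \<mu>\<^sub>T"
      have "norm (?K v w * h w) = \<bar>h w\<bar> * ?K w v"
        using v w poisson_kernel_nonneg[of "of_real r * w" v] sm[of w]
        by (simp add: abs_mult poisson_kernel_swap[of v w])
      then show "ennreal (norm (?K v w * h w)) = ennreal \<bar>h w\<bar> * ennreal (?K w v)"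
        by (simp add: ennreal_mult')
    qed
    also have "\<dots> = ennreal \<bar>h w\<bar> * (\<integral>\<^sup>+v. ennreal (?K w v) \<partial>\<mu>\<^sub>T)"
      using w borel_measurable_circle_continuous[OF continuous_on_poisson_kernel[OF sm[of w]]]
      by (intro nn_integral_cmult) simp
    also have "(\<integral>\<^sup>+v. ennreal (?K w v) \<partial>\<mu>\<^sub>T) = ennreal 1"
      using w sm[of w]
      by (subst nn_integral_eq_integral)
         (auto simp: integral_poisson_kernel intro!: integrable_circle_continuous continuous_on_poisson_kernel
            poisson_kernel_nonneg)
    finally show "(\<integral>\<^sup>+v. norm (?K v w * h w) \<partial>\<mu>\<^sub>T) = ennreal (norm (h w))" by simp
  qed
  finally have le: "(\<integral>\<^sup>+v. norm (?H v) \<partial>\<mu>\<^sub>T) \<le> (\<integral>\<^sup>+w. norm (h w) \<partial>\<mu>\<^sub>T)" .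
  have fin: "(\<integral>\<^sup>+w. norm (h w) \<partial>\<mu>\<^sub>T) = ennreal (\<integral>w. norm (h w) \<partial>\<mu>\<^sub>T)"
    using h by (intro nn_integral_eq_integral integrable_norm) auto
  show int: "integrable \<mu>\<^sub>T ?H"
    by (rule integrableI_bounded[OF meas]) (use le fin in \<open>simp add: le_less_trans\<close>)
  have "(\<integral>\<^sup>+v. norm (?H v) \<partial>\<mu>\<^sub>T) = ennreal (\<integral>v. norm (?H v) \<partial>\<mu>\<^sub>T)"
    using int by (intro nn_integral_eq_integral integrable_norm) auto
  then show "(\<integral>v. \<bar>?H v\<bar> \<partial>\<mu>\<^sub>T) \<le> (\<integral>w. \<bar>h w\<bar> \<partial>\<mu>\<^sub>T)"
    using le fin by (simp add: ennreal_le_iff integral_nonneg_AE)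
qed

text \<open>Near \<open>v\<close> uniform continuity controls the difference of values; away from
  \<open>v\<close> the kernel is small, uniformly in \<open>v\<close>, because its numerator 1 - r^2
  tends to 0.\<close>

lemma poisson_uniform_tendsto:
  fixes g :: "complex \<Rightarrow> real"
  assumes g: "continuous_on UNIV g" and r: "\<And>j. 0 \<le> r j" "\<And>j. r j < 1" "r \<longlonglongrightarrow> 1" and "\<epsilon> > 0"
  shows "\<forall>\<^sub>F j in sequentially. \<forall>v\<in>sphere 0 1.
           \<bar>(\<integral>w. poisson_kernel (of_real (r j) * v) w * g w \<partial>\<mu>\<^sub>T) - g v\<bar> \<le> \<epsilon>"
proof -
  have gs: "continuous_on (sphere 0 1) g" using g continuous_on_subset by blast
  have "uniformly_continuous_on (sphere 0 1) g"
    by (rule compact_uniformly_continuous[OF gs]) auto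
  then obtain \<delta> where \<delta>: "\<delta> > 0"
      "\<And>v w. v \<in> sphere 0 1 \<Longrightarrow> w \<in> sphere 0 1 \<Longrightarrow> dist w v < \<delta> \<Longrightarrow> dist (g w) (g v) < \<epsilon> / 2"
    using \<open>\<epsilon> > 0\<close> unfolding uniformly_continuous_on_def by (metis half_gt_zero)
  have "bounded (g ` sphere 0 1)"
    by (intro compact_imp_bounded compact_continuous_image gs) auto
  then obtain M where M: "\<And>w. w \<in> sphere 0 1 \<Longrightarrow> \<bar>g w\<bar> \<le> M"
    unfolding bounded_iff real_norm_def by blast
  have "M \<ge> 0" using M[of 1] by simp
  have "(\<lambda>j. 2 * M * ((1 - (r j)\<^sup>2) / (\<delta> / 2)\<^sup>2)) \<longlonglongrightarrow> 2 * M * ((1 - 1\<^sup>2) / (\<delta> / 2)\<^sup>2)"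
    using \<delta>(1) by (intro tendsto_intros r) auto
  then have "\<forall>\<^sub>F j in sequentially. 2 * M * ((1 - (r j)\<^sup>2) / (\<delta> / 2)\<^sup>2) < \<epsilon> / 2"
    by (rule order_tendstoD) (use \<open>\<epsilon> > 0\<close> in simp)
  \<comment> \<open>The base point r v is then within \<delta>/2 of \<open>v\<close>, so a
    \<open>w\<close> at distance at least \<delta> from \<open>v\<close> is at distance at least
    \<delta>/2 from the base point.\<close>
  moreover have "\<forall>\<^sub>F j in sequentially. r j > 1 - \<delta> / 2"
    using r(3) by (rule order_tendstoD) (use \<delta> in simp)
  ultimately show ?thesis
  proof eventually_elim
    case (elim j)
    show ?case
    proof
      fix v :: complex assume v: "v \<in> sphere 0 1"
      let ?z = "of_real (r j) * v"
      have z: "cmod ?z < 1" "cmod ?z = r j" using v r(1)[of j] r(2)[of j] by (simp_all add: norm_mult)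
      \<comment> \<open>Bound for the far part: 2 M for the difference of values, the quotient for
        the kernel.\<close>
      define C where "C = 2 * M * ((1 - (r j)\<^sup>2) / (\<delta> / 2)\<^sup>2)"
      have K: "integrable \<mu>\<^sub>T (poisson_kernel ?z)" "integrable \<mu>\<^sub>T (\<lambda>w. poisson_kernel ?z w * g w)"
        using z(1) by (intro integrable_poisson_kernel_mult integrable_circle_continuous continuous_on_poisson_kernel gs; simp)+
      have pt: "\<bar>poisson_kernel ?z w * (g w - g v)\<bar> \<le> \<epsilon> / 2 * poisson_kernel ?z w + C"
        if w: "w \<in> sphere 0 1" for w
      proof (cases "dist w v < \<delta>")
        case True
        have "\<bar>g w - g v\<bar> \<le> \<epsilon> / 2"
          using \<delta>(2)[OF v w True] by (simp add: dist_real_def)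
        then have "\<bar>poisson_kernel ?z w * (g w - g v)\<bar> \<le> \<epsilon> / 2 * poisson_kernel ?z w"
          using poisson_kernel_nonneg[of ?z w] z mult_right_mono[of _ "\<epsilon> / 2" "poisson_kernel ?z w"]
          by (simp add: abs_mult mult.commute)
        moreover have "C \<ge> 0"
          using \<open>M \<ge> 0\<close> r(1)[of j] r(2)[of j] by (simp add: C_def abs_square_le_1)
        ultimately show ?thesis by linarith
      next
        case False
        have "cmod (v - ?z) = 1 - r j"
        proof -
          have "v - ?z = of_real (1 - r j) * v" by (simp add: algebra_simps)
          then show ?thesis using v r(2)[of j] by (simp only: norm_mult norm_of_real) simp
        qed
        then have "\<delta> / 2 \<le> cmod (w - ?z)"
          using False elim(2) norm_triangle_ineq[of "w - ?z" "?z - v"] by (simp add: dist_norm norm_minus_commute)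
        then have "(\<delta> / 2)\<^sup>2 \<le> (cmod (w - ?z))\<^sup>2" using \<delta>(1) by (intro power_mono) auto
        then have "poisson_kernel ?z w \<le> (1 - (r j)\<^sup>2) / (\<delta> / 2)\<^sup>2"
          unfolding poisson_kernel_def z(2) using \<delta>(1) r(1)[of j] r(2)[of j]
          by (intro divide_left_mono) (auto simp: abs_square_le_1 zero_less_mult_iff)
        moreover have "\<bar>g w - g v\<bar> \<le> 2 * M" using M[OF v] M[OF w] by linarith
        ultimately have "\<bar>g w - g v\<bar> * poisson_kernel ?z w \<le> C"
          unfolding C_def using \<open>M \<ge> 0\<close> poisson_kernel_nonneg[of ?z w] z by (intro mult_mono) auto
        moreover have "0 \<le> \<epsilon> / 2 * poisson_kernel ?z w"
          using poisson_kernel_nonneg[of ?z w] z \<open>\<epsilon> > 0\<close> by simp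
        ultimately show ?thesis
          using poisson_kernel_nonneg[of ?z w] z by (simp add: abs_mult mult.commute)
      qed
      have "(\<integral>w. poisson_kernel ?z w * g w \<partial>\<mu>\<^sub>T) - g v
          = (\<integral>w. poisson_kernel ?z w * g w \<partial>\<mu>\<^sub>T) - (\<integral>w. poisson_kernel ?z w * g v \<partial>\<mu>\<^sub>T)"
        using z by (simp add: integral_poisson_kernel)
      also have "\<dots> = (\<integral>w. poisson_kernel ?z w * (g w - g v) \<partial>\<mu>\<^sub>T)"
        using K by (subst Bochner_Integration.integral_diff[symmetric]) (auto simp: algebra_simps)
      also have "\<bar>\<dots>\<bar> \<le> (\<integral>w. \<bar>poisson_kernel ?z w * (g w - g v)\<bar> \<partial>\<mu>\<^sub>T)"
        by (rule integral_abs_bound)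
      also have "\<dots> \<le> (\<integral>w. \<epsilon> / 2 * poisson_kernel ?z w + C \<partial>\<mu>\<^sub>T)"
        using K pt by (intro integral_mono) (auto simp: right_diff_distrib)
      also have "\<dots> = \<epsilon> / 2 + C" using K z by (simp add: integral_poisson_kernel)
      also have "\<dots> \<le> \<epsilon>" using elim(1) by (simp add: C_def)
      finally show "\<bar>(\<integral>w. poisson_kernel ?z w * g w \<partial>\<mu>\<^sub>T) - g v\<bar> \<le> \<epsilon>" .
    qed
  qed
qed

text \<open>With \<open>g\<close> continuous and close to f in \<open>L^1\<close>, the contraction
  bounds the Poisson integral of f - g, uniform convergence treats \<open>g\<close>, and f - g
  itself is small.\<close>

lemma poisson_L1_tendsto:
  fixes f :: "complex \<Rightarrow> real"
  assumes f: "integrable \<mu>\<^sub>T f" and r: "\<And>j. 0 \<le> r j" "\<And>j. r j < 1" "r \<longlonglongrightarrow> 1"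
  shows "(\<lambda>j. \<integral>v. \<bar>(\<integral>w. poisson_kernel (of_real (r j) * v) w * f w \<partial>\<mu>\<^sub>T) - f v\<bar> \<partial>\<mu>\<^sub>T) \<longlonglongrightarrow> 0"
proof (rule tendstoI)
  fix \<epsilon> :: real assume "\<epsilon> > 0"
  let ?P = "\<lambda>j f v. \<integral>w. poisson_kernel (of_real (r j) * v) w * f w \<partial>\<mu>\<^sub>T"
  obtain g where g: "continuous_on UNIV g" "(\<integral>w. \<bar>f w - g w\<bar> \<partial>\<mu>\<^sub>T) < \<epsilon> / 3"
    using circle_continuous_dense[OF f, of "\<epsilon> / 3"] \<open>\<epsilon> > 0\<close> by auto
  have gi: "integrable \<mu>\<^sub>T g"
    by (rule integrable_circle_continuous_UNIV[OF g(1)])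
  have fg: "integrable \<mu>\<^sub>T (\<lambda>w. f w - g w)" using f gi by simp
  have "\<forall>\<^sub>F j in sequentially. \<forall>v\<in>sphere 0 1. \<bar>?P j g v - g v\<bar> \<le> \<epsilon> / 3"
    using \<open>\<epsilon> > 0\<close> by (intro poisson_uniform_tendsto[OF g(1) r]) auto
  then show "\<forall>\<^sub>F j in sequentially. dist (\<integral>v. \<bar>?P j f v - f v\<bar> \<partial>\<mu>\<^sub>T) 0 < \<epsilon>"
  proof eventually_elim
    case (elim j)
    note c = poisson_L1_contraction[OF _ r(1)[of j] r(2)[of j]]
    have "(\<integral>v. \<bar>?P j f v - f v\<bar> \<partial>\<mu>\<^sub>T)
        \<le> (\<integral>v. \<bar>?P j (\<lambda>w. f w - g w) v\<bar> + \<epsilon> / 3 + \<bar>f v - g v\<bar> \<partial>\<mu>\<^sub>T)"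
    proof (rule integral_mono)
      fix v assume "v \<in> space \<mu>\<^sub>T"
      then have v: "v \<in> sphere 0 1" "cmod (of_real (r j) * v) < 1"
        using r(1)[of j] r(2)[of j] by (auto simp: norm_mult)
      have "?P j (\<lambda>w. f w - g w) v = ?P j f v - ?P j g v"
        unfolding right_diff_distrib
        by (intro Bochner_Integration.integral_diff integrable_poisson_kernel_mult f gi v(2))
      then show "\<bar>?P j f v - f v\<bar> \<le> \<bar>?P j (\<lambda>w. f w - g w) v\<bar> + \<epsilon> / 3 + \<bar>f v - g v\<bar>"
        using bspec[OF elim v(1)] by linarith
    qed (use c(1) f fg gi in auto)
    also have "\<dots> = (\<integral>v. \<bar>?P j (\<lambda>w. f w - g w) v\<bar> \<partial>\<mu>\<^sub>T) + \<epsilon> / 3 + (\<integral>v. \<bar>f v - g v\<bar> \<partial>\<mu>\<^sub>T)"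
      using c(1)[OF fg] fg by simp
    also have "\<dots> < \<epsilon>" using c(2)[OF fg] g(2) by linarith
    finally show ?case by (simp add: dist_real_def)
  qed
qed

subsection \<open>Radial limits of bounded holomorphic functions\<close>

text \<open>The total mass is 1, so the difference of the two sides is a variance.\<close>

lemma circle_integral_square_le:
  fixes h :: "complex \<Rightarrow> real"
  assumes "integrable \<mu>\<^sub>T h" "integrable \<mu>\<^sub>T (\<lambda>w. (h w)\<^sup>2)"
  shows "(\<integral>w. h w \<partial>\<mu>\<^sub>T)\<^sup>2 \<le> (\<integral>w. (h w)\<^sup>2 \<partial>\<mu>\<^sub>T)"
proof -
  define m where "m = (\<integral>w. h w \<partial>\<mu>\<^sub>T)"
  have "0 \<le> (\<integral>w. (h w - m)\<^sup>2 \<partial>\<mu>\<^sub>T)" by simp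
  also have "\<dots> = (\<integral>w. (h w)\<^sup>2 - 2 * m * h w + m\<^sup>2 \<partial>\<mu>\<^sub>T)"
    by (simp add: power2_diff algebra_simps)
  also have "\<dots> = (\<integral>w. (h w)\<^sup>2 \<partial>\<mu>\<^sub>T) - m\<^sup>2"
    using assms by (simp add: m_def[symmetric] power2_eq_square)
  finally show ?thesis by (simp add: m_def)
qed

text \<open>The completeness argument for \<open>L^1\<close>: along indices whose differences have
  norm below 2^-k the increments are absolutely summable almost everywhere. The pointwise limit
  along them is what carries the bound \<open>C\<close> over to \<open>s\<close>.\<close>

lemma bounded_L1_Cauchy_limit:
  fixes G :: "nat \<Rightarrow> complex \<Rightarrow> complex"
  assumes G [measurable]: "\<And>j. G j \<in> borel_measurable \<mu>\<^sub>T"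
    and bd: "\<And>j w. w \<in> sphere 0 1 \<Longrightarrow> cmod (G j w) \<le> C"
    and Cauchy: "\<And>\<epsilon>. \<epsilon> > 0 \<Longrightarrow> \<exists>N. \<forall>i\<ge>N. \<forall>j\<ge>N. (\<integral>w. cmod (G i w - G j w) \<partial>\<mu>\<^sub>T) < \<epsilon>"
  shows "\<exists>s\<in>borel_measurable \<mu>\<^sub>T. (AE w in \<mu>\<^sub>T. cmod (s w) \<le> C) \<and>
            (\<lambda>j. \<integral>w. cmod (G j w - s w) \<partial>\<mu>\<^sub>T) \<longlonglongrightarrow> 0"
proof -
  have Gi [simp]: "integrable \<mu>\<^sub>T (G j)" for j
    by (rule circle.integrable_const_bound[of _ C]) (use bd in auto)
  have "\<forall>k. \<exists>N. \<forall>i\<ge>N. \<forall>j\<ge>N. (\<integral>w. cmod (G i w - G j w) \<partial>\<mu>\<^sub>T) < (1 / 2) ^ k"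
    by (intro allI Cauchy) simp
  then obtain N where N: "\<And>k i j. i \<ge> N k \<Longrightarrow> j \<ge> N k \<Longrightarrow>
      (\<integral>w. cmod (G i w - G j w) \<partial>\<mu>\<^sub>T) < (1 / 2) ^ k"
    by metis
  \<comment> \<open>The maximum makes \<open>r\<close> strictly increasing and keeps
    \<open>r k\<close> at or above \<open>N k\<close>.\<close>
  define r where "r = rec_nat (N 0) (\<lambda>k m. max (Suc m) (N (Suc k)))"
  have r_Suc: "r (Suc k) = max (Suc (r k)) (N (Suc k))" for k by (simp add: r_def)
  have rN: "r k \<ge> N k" for k by (cases k) (auto simp: r_def)
  have rmono: "strict_mono r" by (simp add: strict_mono_Suc_iff r_Suc less_max_iff_disj)
  let ?d = "\<lambda>k w. G (r (Suc k)) w - G (r k) w"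
  have d: "(\<integral>w. cmod (?d k w) \<partial>\<mu>\<^sub>T) \<le> (1 / 2) ^ k" for k
    using N[of k "r (Suc k)" "r k"] rN[of k] by (simp add: r_Suc less_imp_le)
  have "(\<integral>\<^sup>+w. (\<Sum>k. ennreal (cmod (?d k w))) \<partial>\<mu>\<^sub>T) = (\<Sum>k. \<integral>\<^sup>+w. ennreal (cmod (?d k w)) \<partial>\<mu>\<^sub>T)"
    by (rule nn_integral_suminf) measurable
  also have "\<dots> = (\<Sum>k. ennreal (\<integral>w. cmod (?d k w) \<partial>\<mu>\<^sub>T))"
    by (intro suminf_cong nn_integral_eq_integral) auto
  also have "\<dots> \<le> (\<Sum>k. ennreal ((1 / 2) ^ k))"
    using d by (intro suminf_le ennreal_leI) auto
  also have "\<dots> = ennreal (\<Sum>k. (1 / 2) ^ k)"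
    by (rule suminf_ennreal2) auto
  finally have "(\<integral>\<^sup>+w. (\<Sum>k. ennreal (cmod (?d k w))) \<partial>\<mu>\<^sub>T) \<noteq> \<infinity>"
    using neq_top_trans[OF ennreal_neq_top] unfolding infinity_ennreal_def by blast
  then have "AE w in \<mu>\<^sub>T. (\<Sum>k. ennreal (cmod (?d k w))) \<noteq> \<infinity>"
    by (intro nn_integral_PInf_AE) measurable
  then have conv: "AE w in \<mu>\<^sub>T. (\<lambda>k. G (r k) w) \<longlonglongrightarrow> lim (\<lambda>k. G (r k) w)"
  proof eventually_elim
    case (elim w)
    then have "summable (\<lambda>k. cmod (?d k w))"
      by (intro summable_suminf_not_top) auto
    then have "(\<lambda>n. \<Sum>k<n. ?d k w) \<longlonglongrightarrow> (\<Sum>k. ?d k w)"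
      by (rule summable_LIMSEQ[OF summable_norm_cancel])
    then have "(\<lambda>n. G (r n) w - G (r 0) w) \<longlonglongrightarrow> (\<Sum>k. ?d k w)"
      by (simp only: sum_lessThan_telescope[of "\<lambda>k. G (r k) w"])
    from tendsto_add[OF this tendsto_const[of "G (r 0) w"]]
    have "convergent (\<lambda>n. G (r n) w)" by (simp add: convergentI)
    then show ?case by (simp add: convergent_LIMSEQ_iff)
  qed
  \<comment> \<open>Taking \<open>lim\<close> at every point gives a measurable function; its values
    on the null set of divergence are arbitrary.\<close>
  define s where "s = (\<lambda>w. lim (\<lambda>k. G (r k) w))"
  have s [measurable]: "s \<in> borel_measurable \<mu>\<^sub>T" unfolding s_def by measurable
  have sb: "AE w in \<mu>\<^sub>T. cmod (s w) \<le> C"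
    using conv AE_space
  proof eventually_elim
    case (elim w)
    then show ?case unfolding s_def
      using elim(2) bd[of w] by (intro LIMSEQ_le_const2[OF tendsto_norm[OF elim(1)]]) simp
  qed
  have si: "integrable \<mu>\<^sub>T s" by (rule circle.integrable_const_bound[OF sb s])
  have "(\<lambda>k. \<integral>w. cmod (G (r k) w - s w) \<partial>\<mu>\<^sub>T) \<longlonglongrightarrow> (\<integral>w. 0 \<partial>\<mu>\<^sub>T)"
  proof (rule integral_dominated_convergence[where w = "\<lambda>w. 2 * C"])
    show "AE w in \<mu>\<^sub>T. (\<lambda>k. cmod (G (r k) w - s w)) \<longlonglongrightarrow> 0"
      using conv by eventually_elim (simp add: s_def tendsto_norm_zero LIM_zero)
    show "AE w in \<mu>\<^sub>T. norm (cmod (G (r k) w - s w)) \<le> 2 * C" for k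
      using sb AE_space
    proof eventually_elim
      case (elim w)
      then show ?case using bd[of w "r k"] norm_triangle_ineq4[of "G (r k) w" "s w"] by auto
    qed
  qed auto
  then have lim: "(\<lambda>k. \<integral>w. cmod (G (r k) w - s w) \<partial>\<mu>\<^sub>T) \<longlonglongrightarrow> 0" by simp
  have "(\<lambda>j. \<integral>w. cmod (G j w - s w) \<partial>\<mu>\<^sub>T) \<longlonglongrightarrow> 0"
  proof (rule LIMSEQ_I)
    fix \<epsilon> :: real assume "\<epsilon> > 0"
    then obtain M where M: "\<And>i j. i \<ge> M \<Longrightarrow> j \<ge> M \<Longrightarrow> (\<integral>w. cmod (G i w - G j w) \<partial>\<mu>\<^sub>T) < \<epsilon> / 2"
      using Cauchy[of "\<epsilon> / 2"] by auto
    have "\<forall>\<^sub>F k in sequentially. (\<integral>w. cmod (G (r k) w - s w) \<partial>\<mu>\<^sub>T) < \<epsilon> / 2"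
      using lim \<open>\<epsilon> > 0\<close> by (intro order_tendstoD(2)) auto
    then obtain k where k: "k \<ge> M" "(\<integral>w. cmod (G (r k) w - s w) \<partial>\<mu>\<^sub>T) < \<epsilon> / 2"
      using eventually_happens[OF eventually_conj[OF eventually_ge_at_top[of M]]] by auto
    have "(\<integral>w. cmod (G j w - s w) \<partial>\<mu>\<^sub>T) < \<epsilon>" if "j \<ge> M" for j
    proof -
      have "(\<integral>w. cmod (G j w - s w) \<partial>\<mu>\<^sub>T)
          \<le> (\<integral>w. cmod (G j w - G (r k) w) + cmod (G (r k) w - s w) \<partial>\<mu>\<^sub>T)"
      proof (rule integral_mono)
        show "cmod (G j w - s w) \<le> cmod (G j w - G (r k) w) + cmod (G (r k) w - s w)" for w
          using norm_triangle_ineq[of "G j w - G (r k) w" "G (r k) w - s w"] by simp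
      qed (use si in auto)
      also have "\<dots> = (\<integral>w. cmod (G j w - G (r k) w) \<partial>\<mu>\<^sub>T) + (\<integral>w. cmod (G (r k) w - s w) \<partial>\<mu>\<^sub>T)"
        using si by simp
      also have "\<dots> < \<epsilon>"
        using M[of j "r k"] k that strict_mono_imp_increasing[OF rmono, of k] by simp
      finally show ?thesis .
    qed
    then show "\<exists>M. \<forall>j\<ge>M. norm ((\<integral>w. cmod (G j w - s w) \<partial>\<mu>\<^sub>T) - 0) < \<epsilon>"
      by auto
  qed
  with s sb show ?thesis by blast
qed

lemma power_series_circle_integral:
  fixes a :: "nat \<Rightarrow> complex" and \<phi> :: "complex \<Rightarrow> complex"
  assumes F: "\<And>z. cmod z < 1 \<Longrightarrow> (\<lambda>n. a n * z ^ n) sums F z"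
    and r: "0 \<le> r" "r < 1" and \<phi>: "integrable \<mu>\<^sub>T \<phi>"
  shows "(\<lambda>n. (a n * of_real r ^ n) * (\<integral>w. \<phi> w * w ^ n \<partial>\<mu>\<^sub>T)) sums (\<integral>w. \<phi> w * F (of_real r * w) \<partial>\<mu>\<^sub>T)"
    and "(\<lambda>n. (cnj (a n) * of_real r ^ n) * (\<integral>w. \<phi> w * cnj w ^ n \<partial>\<mu>\<^sub>T)) sums
            (\<integral>w. \<phi> w * cnj (F (of_real r * w)) \<partial>\<mu>\<^sub>T)"
proof -
  \<comment> \<open>Convergence at a radius strictly between r and 1 gives absolute convergence at
    r, as termwise integration demands.\<close>
  define x where "x = (1 + r) / 2"
  have x: "r < x" "x < 1" using r by (auto simp: x_def)
  have "summable (\<lambda>n. a n * of_real x ^ n)"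
    using F[of "of_real x"] x r by (auto simp: sums_iff)
  then have su: "summable (\<lambda>n. cmod (a n * of_real r ^ n))"
    by (rule powser_insidea) (use x r in auto)
  have sm: "cmod (of_real r * w) < 1" if "w \<in> sphere 0 1" for w
    using that r by (simp add: norm_mult)
  show "(\<lambda>n. (a n * of_real r ^ n) * (\<integral>w. \<phi> w * w ^ n \<partial>\<mu>\<^sub>T)) sums (\<integral>w. \<phi> w * F (of_real r * w) \<partial>\<mu>\<^sub>T)"
    using F[OF sm]
    by (intro sums_integral_circle_series \<phi> su)
       (auto simp: norm_power power_mult_distrib mult.assoc)
  show "(\<lambda>n. (cnj (a n) * of_real r ^ n) * (\<integral>w. \<phi> w * cnj w ^ n \<partial>\<mu>\<^sub>T)) sums
            (\<integral>w. \<phi> w * cnj (F (of_real r * w)) \<partial>\<mu>\<^sub>T)"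
  proof (rule sums_integral_circle_series[OF \<phi>])
    show "summable (\<lambda>n. cmod (cnj (a n) * of_real r ^ n))" using su by (simp add: norm_mult)
    fix w :: complex assume "w \<in> sphere 0 1"
    from sums_cnj[THEN iffD2, OF F[OF sm[OF this]]]
    show "(\<lambda>n. cnj (a n) * of_real r ^ n * cnj w ^ n) sums cnj (F (of_real r * w))"
      by (simp add: power_mult_distrib mult.assoc)
  qed (auto simp: norm_power intro!: borel_measurable_circle_continuous continuous_intros)
qed

text \<open>The power series is integrated termwise against \<open>w ^ n\<close>, including n = 0,
  and against the Poisson kernel; dilation by r < 1 makes it absolutely summable on the
  circle.\<close>

lemma holomorphic_circle_means:
  assumes F: "F holomorphic_on ball 0 1" and r: "0 \<le> r" "r < 1"
  shows "(\<integral>w. F (of_real r * w) \<partial>\<mu>\<^sub>T) = F 0"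
    and "n \<ge> 1 \<Longrightarrow> (\<integral>w. F (of_real r * w) * w ^ n \<partial>\<mu>\<^sub>T) = 0"
    and "cmod z < 1 \<Longrightarrow> (\<integral>w. of_real (poisson_kernel z w) * F (of_real r * w) \<partial>\<mu>\<^sub>T) = F (of_real r * z)"
proof -
  define a where "a n = (deriv ^^ n) F 0 / fact n" for n
  have a: "(\<lambda>n. a n * z ^ n) sums F z" if "cmod z < 1" for z
    using holomorphic_power_series[OF F, of z] that by (simp add: a_def)
  have pw: "integrable \<mu>\<^sub>T (\<lambda>w. w ^ n)" for n
    by (intro integrable_circle_continuous continuous_intros)
  have "(\<lambda>m. (a m * of_real r ^ m) * (\<integral>w. w ^ n * w ^ m \<partial>\<mu>\<^sub>T)) sums (\<integral>w. w ^ n * F (of_real r * w) \<partial>\<mu>\<^sub>T)" for n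
    by (rule power_series_circle_integral(1)[OF a r pw])
  moreover have "(\<integral>w. w ^ n * w ^ m \<partial>\<mu>\<^sub>T) = (if n + m = 0 then 1 else 0)" for n m
    using integral_circle_power[of "n + m"] by (auto simp flip: power_add)
  ultimately have *: "(\<lambda>m. (a m * of_real r ^ m) * (if n + m = 0 then 1 else 0)) sums (\<integral>w. w ^ n * F (of_real r * w) \<partial>\<mu>\<^sub>T)" for n
    by simp
  show "(\<integral>w. F (of_real r * w) * w ^ n \<partial>\<mu>\<^sub>T) = 0" if "n \<ge> 1"
    using *[of n] that by (simp add: sums_iff mult.commute)
  have "(\<lambda>m. if m = 0 then a m * of_real r ^ m else 0) sums (a 0 * of_real r ^ 0)"
    by (rule sums_single)
  moreover have "(\<lambda>m. (a m * of_real r ^ m) * (if 0 + m = 0 then 1 else 0)) = (\<lambda>m. if m = 0 then a m * of_real r ^ m else 0)"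
    by auto
  ultimately show "(\<integral>w. F (of_real r * w) \<partial>\<mu>\<^sub>T) = F 0"
    using *[of 0] by (simp add: sums_iff a_def)
  assume z: "cmod z < 1"
  have "(\<lambda>m. (a m * of_real r ^ m) * z ^ m) sums (\<integral>w. of_real (poisson_kernel z w) * F (of_real r * w) \<partial>\<mu>\<^sub>T)"
    using power_series_circle_integral(1)[OF a r, of "\<lambda>w. of_real (poisson_kernel z w)"] z
    by (simp add: poisson_kernel_power integrable_circle_continuous continuous_on_poisson_kernel)
  moreover have "cmod (of_real r * z) < 1"
    using r z mult_le_one[of r "cmod z"] by (simp add: norm_mult mult_strict_mono' le_less_trans[OF mult_left_le_one_le])
  then have "(\<lambda>m. (a m * of_real r ^ m) * z ^ m) sums F (of_real r * z)"
    using a[of "of_real r * z"] by (simp add: power_mult_distrib mult.assoc)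
  ultimately show "(\<integral>w. of_real (poisson_kernel z w) * F (of_real r * w) \<partial>\<mu>\<^sub>T) = F (of_real r * z)"
    by (rule sums_unique2)
qed

lemma continuous_on_dilation:
  assumes "F holomorphic_on ball 0 1" "0 \<le> r" "r < 1"
  shows "continuous_on (sphere 0 1) (\<lambda>w. F (of_real r * w))"
  by (intro continuous_on_compose2[OF holomorphic_on_imp_continuous_on[OF assms(1)]] continuous_intros)
     (use assms in \<open>auto simp: norm_mult\<close>)

text \<open>
  By Parseval the inner product of the dilates of \<open>F\<close> by \<open>r\<close> and \<open>\<rho>\<close> is \<open>D (r \<rho>)\<close> for a bounded
  increasing function \<open>D\<close>, which makes the dilates a Cauchy net in \<open>L\<^sup>2\<close>.
\<close>

lemma bounded_holomorphic_radial_limit: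
  assumes F: "F holomorphic_on ball 0 1" and bd: "\<And>z. cmod z < 1 \<Longrightarrow> cmod (F z) \<le> C"
    and r: "\<And>j. 0 \<le> r j" "\<And>j. r j < 1" "r \<longlonglongrightarrow> 1"
  shows "\<exists>s\<in>borel_measurable \<mu>\<^sub>T. (AE w in \<mu>\<^sub>T. cmod (s w) \<le> C) \<and>
            (\<lambda>j. \<integral>w. cmod (F (of_real (r j) * w) - s w) \<partial>\<mu>\<^sub>T) \<longlonglongrightarrow> 0"
proof (rule bounded_L1_Cauchy_limit)
  let ?F = "\<lambda>r w. F (of_real r * w)"
  have cont: "continuous_on (sphere 0 1) (?F r)" if "0 \<le> r" "r < 1" for r
    by (rule continuous_on_dilation[OF F that])
  show "?F (r j) \<in> borel_measurable \<mu>\<^sub>T" for j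
    by (intro borel_measurable_circle_continuous cont r)
  have bdr: "cmod (?F r w) \<le> C" if "0 \<le> r" "r < 1" "w \<in> sphere 0 1" for r w
    using that by (intro bd) (simp add: norm_mult)
  then show "cmod (?F (r j) w) \<le> C" if "w \<in> sphere 0 1" for j w
    using r that by blast
  have "C \<ge> 0" using bd[of 0] norm_ge_zero[of "F 0"] by (simp del: norm_ge_zero)
  define a where "a n = (deriv ^^ n) F 0 / fact n" for n
  have a: "(\<lambda>n. a n * z ^ n) sums F z" if "cmod z < 1" for z
    using holomorphic_power_series[OF F, of z] that by (simp add: a_def)
  define D where "D x = (\<Sum>n. (cmod (a n))\<^sup>2 * x ^ n)" for x :: real
  have ip: "(\<lambda>n. (cmod (a n))\<^sup>2 * (r * \<rho>) ^ n) sums Re (\<integral>w. ?F r w * cnj (?F \<rho> w) \<partial>\<mu>\<^sub>T)"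
    if r: "0 \<le> r" "r < 1" and \<rho>: "0 \<le> \<rho>" "\<rho> < 1" for r \<rho>
  proof -
    have "(\<integral>w. ?F r w * cnj w ^ n \<partial>\<mu>\<^sub>T) = a n * of_real r ^ n" for n
    proof -
      have "(\<lambda>m. (a m * of_real r ^ m) * (\<integral>w. cnj w ^ n * w ^ m \<partial>\<mu>\<^sub>T)) sums (\<integral>w. cnj w ^ n * ?F r w \<partial>\<mu>\<^sub>T)"
        by (rule power_series_circle_integral(1)[OF a r])
           (auto intro!: integrable_circle_continuous continuous_intros)
      moreover have "(\<lambda>m. (a m * of_real r ^ m) * (\<integral>w. cnj w ^ n * w ^ m \<partial>\<mu>\<^sub>T))
          = (\<lambda>m. if m = n then a m * of_real r ^ m else 0)"
        using integral_circle_moments by (auto simp: mult.commute)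
      ultimately show ?thesis
        using sums_single[of n "\<lambda>m. a m * of_real r ^ m"] by (simp add: sums_iff mult.commute)
    qed
    then have "(\<lambda>n. (cnj (a n) * of_real \<rho> ^ n) * (a n * of_real r ^ n)) sums (\<integral>w. ?F r w * cnj (?F \<rho> w) \<partial>\<mu>\<^sub>T)"
      using power_series_circle_integral(2)[OF a \<rho> integrable_circle_continuous[OF cont[OF r]]] by simp
    moreover have "(cnj (a n) * of_real \<rho> ^ n) * (a n * of_real r ^ n) = of_real ((cmod (a n))\<^sup>2 * (r * \<rho>) ^ n)" for n
      using complex_norm_square[of "a n"] by (simp add: power_mult_distrib mult_ac)
    ultimately have "(\<lambda>n. of_real ((cmod (a n))\<^sup>2 * (r * \<rho>) ^ n)) sums (\<integral>w. ?F r w * cnj (?F \<rho> w) \<partial>\<mu>\<^sub>T)"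
      by simp
    from sums_Re[OF this] show ?thesis by simp
  qed
  have D_ip: "D (r * \<rho>) = Re (\<integral>w. ?F r w * cnj (?F \<rho> w) \<partial>\<mu>\<^sub>T)"
    if "0 \<le> r" "r < 1" "0 \<le> \<rho>" "\<rho> < 1" for r \<rho>
    using ip[OF that] by (simp add: D_def sums_iff)
  have sq: "D (r * r) = (\<integral>w. (cmod (?F r w))\<^sup>2 \<partial>\<mu>\<^sub>T)" if "0 \<le> r" "r < 1" for r
  proof -
    have eq: "(\<integral>w. ?F r w * cnj (?F r w) \<partial>\<mu>\<^sub>T) = (\<integral>w. of_real ((cmod (?F r w))\<^sup>2) \<partial>\<mu>\<^sub>T)"
      by (intro Bochner_Integration.integral_cong refl) (simp flip: complex_norm_square)
    show ?thesis
      unfolding D_ip[OF that that] eq by (simp only: integral_complex_of_real Re_complex_of_real)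
  qed
  have Dsum: "summable (\<lambda>n. (cmod (a n))\<^sup>2 * x ^ n)" if "0 \<le> x" "x < 1" for x
    using ip[of "sqrt x" "sqrt x"] that by (auto simp: sums_iff)
  have Dmono: "D x \<le> D y" if "0 \<le> x" "x \<le> y" "y < 1" for x y
    unfolding D_def using that
    by (intro suminf_le Dsum mult_left_mono power_mono) auto
  have Dbd: "D x \<le> C\<^sup>2" if "0 \<le> x" "x < 1" for x
  proof -
    have s: "0 \<le> sqrt x" "sqrt x < 1" using that by auto
    have "D x = (\<integral>w. (cmod (?F (sqrt x) w))\<^sup>2 \<partial>\<mu>\<^sub>T)" using sq[OF s] that by simp
    also have "\<dots> \<le> (\<integral>w. C\<^sup>2 \<partial>\<mu>\<^sub>T)"
      using bdr[OF s] by (intro integral_mono integrable_circle_continuous continuous_intros cont s power_mono) auto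
    finally show ?thesis by simp
  qed
  fix \<epsilon> :: real assume "\<epsilon> > 0"
  define L where "L = Sup (D ` {0..<1})"
  have bddD: "bdd_above (D ` {0..<1})" using Dbd by (auto intro!: bdd_aboveI2)
  \<comment> \<open>Once all D (r i r j) lie above L - eps^2/2 and at most at L, the squared
    distance D (r i r i) + D (r j r j) - 2 D (r i r j) is below 2 L - 2 (L - eps^2/2) =
    eps^2.\<close>
  have "\<exists>x\<in>{0..<1}. L - \<epsilon>\<^sup>2 / 2 < D x"
    using \<open>\<epsilon> > 0\<close> bddD less_cSUP_iff[of "{0..<1}" D "L - \<epsilon>\<^sup>2 / 2"] by (auto simp: L_def)
  then obtain x where x: "0 \<le> x" "x < 1" "L - \<epsilon>\<^sup>2 / 2 < D x" by auto
  \<comment> \<open>Two radii above sqrt x have a product at or above x, where monotonicity of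
    \<open>D\<close> applies.\<close>
  have "\<forall>\<^sub>F j in sequentially. r j > sqrt x"
    using r(3) by (rule order_tendstoD) (use x in auto)
  then obtain N where N: "\<And>j. j \<ge> N \<Longrightarrow> r j > sqrt x" by (auto simp: eventually_sequentially)
  have "(\<integral>w. cmod (?F (r i) w - ?F (r j) w) \<partial>\<mu>\<^sub>T) < \<epsilon>" if "i \<ge> N" "j \<ge> N" for i j
  proof -
    have rr: "x \<le> r i * r j" "r i * r j < 1" if "i \<ge> N" "j \<ge> N" for i j
    proof -
      have "sqrt x * sqrt x \<le> r i * r j"
        using N[OF that(1)] N[OF that(2)] x r(1) by (intro mult_mono) auto
      then show "x \<le> r i * r j" using x by simp
      have "r i * r j \<le> r i * 1" using r(1)[of i] r(2)[of j] by (intro mult_left_mono) auto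
      then show "r i * r j < 1" using r(2)[of i] by linarith
    qed
    have bounds: "L - \<epsilon>\<^sup>2 / 2 < D (r i * r j)" "D (r i * r j) \<le> L" if "i \<ge> N" "j \<ge> N" for i j
    proof -
      show "L - \<epsilon>\<^sup>2 / 2 < D (r i * r j)" using Dmono[OF x(1) rr[OF that]] x(3) by linarith
      show "D (r i * r j) \<le> L" unfolding L_def
        using rr[OF that] r by (intro cSUP_upper bddD) auto
    qed
    note c = cont[OF r(1)[of i] r(2)[of i]] cont[OF r(1)[of j] r(2)[of j]]
    have "(\<integral>w. cmod (?F (r i) w - ?F (r j) w) \<partial>\<mu>\<^sub>T)\<^sup>2 \<le> (\<integral>w. (cmod (?F (r i) w - ?F (r j) w))\<^sup>2 \<partial>\<mu>\<^sub>T)"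
      by (intro circle_integral_square_le integrable_circle_continuous continuous_intros c)
    also have "\<dots> = (\<integral>w. (cmod (?F (r i) w))\<^sup>2 + (cmod (?F (r j) w))\<^sup>2 - 2 * Re (?F (r i) w * cnj (?F (r j) w)) \<partial>\<mu>\<^sub>T)"
    proof (intro Bochner_Integration.integral_cong refl)
      have "(cmod (x - y))\<^sup>2 = (cmod x)\<^sup>2 + (cmod y)\<^sup>2 - 2 * Re (x * cnj y)" for x y
        unfolding cmod_power2 by (simp add: power2_eq_square algebra_simps)
      then show "(cmod (?F (r i) w - ?F (r j) w))\<^sup>2 = (cmod (?F (r i) w))\<^sup>2 + (cmod (?F (r j) w))\<^sup>2
          - 2 * Re (?F (r i) w * cnj (?F (r j) w))" for w .
    qed
    also have "\<dots> = (\<integral>w. (cmod (?F (r i) w))\<^sup>2 \<partial>\<mu>\<^sub>T) + (\<integral>w. (cmod (?F (r j) w))\<^sup>2 \<partial>\<mu>\<^sub>T)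
        - 2 * (\<integral>w. Re (?F (r i) w * cnj (?F (r j) w)) \<partial>\<mu>\<^sub>T)"
    proof -
      have "integrable \<mu>\<^sub>T (\<lambda>w. (cmod (?F (r i) w))\<^sup>2)" "integrable \<mu>\<^sub>T (\<lambda>w. (cmod (?F (r j) w))\<^sup>2)"
        "integrable \<mu>\<^sub>T (\<lambda>w. Re (?F (r i) w * cnj (?F (r j) w)))"
        by (intro integrable_circle_continuous continuous_intros c)+
      then show ?thesis
        by (simp only: Bochner_Integration.integral_diff Bochner_Integration.integral_add
            Bochner_Integration.integrable_add integrable_mult_right integral_mult_right_zero)
    qed
    also have "(\<integral>w. Re (?F (r i) w * cnj (?F (r j) w)) \<partial>\<mu>\<^sub>T) = Re (\<integral>w. ?F (r i) w * cnj (?F (r j) w) \<partial>\<mu>\<^sub>T)"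
      by (intro integral_Re integrable_circle_continuous continuous_intros c)
    also have "(\<integral>w. (cmod (?F (r i) w))\<^sup>2 \<partial>\<mu>\<^sub>T) + (\<integral>w. (cmod (?F (r j) w))\<^sup>2 \<partial>\<mu>\<^sub>T) - 2 * \<dots>
        = D (r i * r i) + D (r j * r j) - 2 * D (r i * r j)"
      using r by (simp add: sq D_ip)
    also have "\<dots> < \<epsilon>\<^sup>2"
      using bounds(2)[OF that(1) that(1)] bounds(2)[OF that(2) that(2)] bounds(1)[OF that] by linarith
    finally show ?thesis using \<open>\<epsilon> > 0\<close> by (simp add: power_less_imp_less_base)
  qed
  then show "\<exists>N. \<forall>i\<ge>N. \<forall>j\<ge>N. (\<integral>w. cmod (?F (r i) w - ?F (r j) w) \<partial>\<mu>\<^sub>T) < \<epsilon>" by blast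
qed

subsection \<open>Outer functions with prescribed modulus\<close>

lemma integrable_circle_mult_continuous:
  fixes \<phi> g :: "complex \<Rightarrow> complex"
  assumes "integrable \<mu>\<^sub>T \<phi>" "continuous_on (sphere 0 1) g"
  shows "integrable \<mu>\<^sub>T (\<lambda>w. \<phi> w * g w)"
proof -
  have "bounded (g ` sphere 0 1)"
    by (intro compact_imp_bounded compact_continuous_image assms) auto
  then obtain B where "\<And>w. w \<in> sphere 0 1 \<Longrightarrow> cmod (g w) \<le> B"
    unfolding bounded_iff by blast
  then show ?thesis
    using assms by (intro integrable_circle_mult_bounded[of _ _ B] borel_measurable_circle_continuous AE_I2) auto
qed

text \<open>The exponential in \<open>outer\<close> as a function of the prescribed logarithm f of
  the modulus, since f is known before the boundary function exists. The constant \<open>l\<close>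
  is taken to be 1.\<close>

definition outer_extension :: "(complex \<Rightarrow> real) \<Rightarrow> complex \<Rightarrow> complex" where
  "outer_extension f z = exp (\<integral>w. (w + z) / (w - z) * complex_of_real (f w) \<partial>\<mu>\<^sub>T)"

lemma continuous_on_herglotz_kernel:
  "cmod z < 1 \<Longrightarrow> continuous_on (sphere 0 1) (\<lambda>w. (w + z) / (w - z))"
  by (intro continuous_intros) (auto dest: sphere_neq_ball)

text \<open>The Herglotz kernel is 1 + 2 times the sum of (z cnj w)^n over n >= 1; integrating
  termwise turns the exponent into a power series in z. The coefficients 1, 2, 2, ... are
  \<open>d\<close>.\<close>

lemma holomorphic_outer_extension:
  assumes f: "integrable \<mu>\<^sub>T f"
  shows "outer_extension f holomorphic_on ball 0 1"
proof -
  define d :: "nat \<Rightarrow> complex" where "d n = (if n = 0 then 1 else 2)" for n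
  define c where "c n = (\<integral>w. complex_of_real (f w) * cnj w ^ n \<partial>\<mu>\<^sub>T)" for n :: nat
  let ?g = "\<lambda>z. \<integral>w. complex_of_real (f w) * ((w + z) / (w - z)) \<partial>\<mu>\<^sub>T"
  have "(\<lambda>n. (d n * c n) * (z - 0) ^ n) sums ?g z" if "z \<in> ball 0 1" for z
  proof -
    have z: "cmod z < 1" using that by simp
    have "(\<lambda>n. (d n * z ^ n) * c n) sums ?g z"
      unfolding c_def
    proof (rule sums_integral_circle_series)
      show "integrable \<mu>\<^sub>T (\<lambda>w. complex_of_real (f w))" using f by simp
      have "summable (\<lambda>n. 2 * cmod z ^ n)" using z by (intro summable_mult summable_geometric) simp
      then show "summable (\<lambda>n. cmod (d n * z ^ n))"
        by (rule summable_comparison_test'[of _ 0]) (simp add: norm_mult norm_power d_def)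
      fix w :: complex assume w: "w \<in> sphere 0 1"
      have "cmod (z * cnj w) < 1" using w z by (simp add: norm_mult)
      then have ne: "1 - z * cnj w \<noteq> 0" by force
      have "(\<lambda>n. 2 * (z * cnj w) ^ n - (if n = 0 then 1 else 0)) sums (2 * (1 / (1 - z * cnj w)) - 1)"
        using sums_single[of 0 "\<lambda>_. 1 :: complex"] \<open>cmod (z * cnj w) < 1\<close>
        by (intro sums_diff sums_mult geometric_sums) auto
      moreover have "2 * (1 / (1 - z * cnj w)) - 1 = (w + z) / (w - z)"
      proof -
        have "2 * (1 / (1 - z * cnj w)) - 1 = (1 + z * cnj w) / (1 - z * cnj w)"
          using ne by (simp add: field_simps)
        also have "\<dots> = (w * (1 + z * cnj w)) / (w * (1 - z * cnj w))"
          using w by auto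
        also have "\<dots> = (w + z * (w * cnj w)) / (w - z * (w * cnj w))"
          by (simp add: algebra_simps)
        finally show ?thesis by (simp add: circle_cnj_mult[OF w])
      qed
      moreover have "(\<lambda>n. 2 * (z * cnj w) ^ n - (if n = 0 then 1 else 0)) = (\<lambda>n. d n * z ^ n * cnj w ^ n)"
        by (auto simp: d_def power_mult_distrib)
      ultimately show "(\<lambda>n. d n * z ^ n * cnj w ^ n) sums ((w + z) / (w - z))" by simp
    qed (auto simp: norm_power intro!: borel_measurable_circle_continuous continuous_intros)
    then show ?thesis by (simp add: mult_ac)
  qed
  then have "?g holomorphic_on ball 0 1" by (rule power_series_holomorphic)
  then have "(\<lambda>z. exp (?g z)) holomorphic_on ball 0 1" by (intro holomorphic_intros)
  then show ?thesis by (simp add: outer_extension_def[abs_def] mult.commute)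
qed

lemma cmod_outer_extension:
  assumes "integrable \<mu>\<^sub>T f" "cmod z < 1"
  shows "cmod (outer_extension f z) = exp (\<integral>w. poisson_kernel z w * f w \<partial>\<mu>\<^sub>T)"
proof -
  have "integrable \<mu>\<^sub>T (\<lambda>w. complex_of_real (f w) * ((w + z) / (w - z)))"
    using assms by (intro integrable_circle_mult_continuous continuous_on_herglotz_kernel) auto
  then have "Re (\<integral>w. (w + z) / (w - z) * complex_of_real (f w) \<partial>\<mu>\<^sub>T)
      = (\<integral>w. Re ((w + z) / (w - z) * complex_of_real (f w)) \<partial>\<mu>\<^sub>T)"
    by (subst integral_Re) (simp_all add: mult.commute)
  also have "\<dots> = (\<integral>w. poisson_kernel z w * f w \<partial>\<mu>\<^sub>T)"
  proof (intro Bochner_Integration.integral_cong refl)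
    show "Re ((w + z) / (w - z) * complex_of_real (f w)) = poisson_kernel z w * f w" if "w \<in> space \<mu>\<^sub>T" for w
      using that assms(2) poisson_kernel_eq(2)[of w z]
      by (simp only: times_complex.simps Re_complex_of_real Im_complex_of_real space_circle_measure)
  qed
  finally show ?thesis by (simp add: outer_extension_def norm_exp_eq_Re)
qed

text \<open>The Poisson kernel is a probability density, so an upper bound for f passes to its
  Poisson integral. The bound is one-sided because the logarithm of a modulus may be unbounded
  below.\<close>

lemma cmod_outer_extension_le:
  assumes f: "integrable \<mu>\<^sub>T f" and M: "AE w in \<mu>\<^sub>T. f w \<le> M" and z: "cmod z < 1"
  shows "cmod (outer_extension f z) \<le> exp M"
proof -
  have K: "integrable \<mu>\<^sub>T (poisson_kernel z)"
    by (intro integrable_circle_continuous continuous_on_poisson_kernel z)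
  have "(\<integral>w. poisson_kernel z w * f w \<partial>\<mu>\<^sub>T) \<le> (\<integral>w. poisson_kernel z w * M \<partial>\<mu>\<^sub>T)"
  proof (rule integral_mono_AE)
    show "AE w in \<mu>\<^sub>T. poisson_kernel z w * f w \<le> poisson_kernel z w * M"
      using M by eventually_elim (use z in \<open>simp add: mult_left_mono poisson_kernel_nonneg\<close>)
  qed (use f z K in \<open>auto intro!: integrable_poisson_kernel_mult\<close>)
  also have "\<dots> = M" using z K by (simp add: integral_poisson_kernel)
  finally show ?thesis using z f by (simp add: cmod_outer_extension)
qed

text \<open>At z = 0 the Herglotz kernel is 1. The value is a positive real, which fixes the phase
  of the means of products computed later.\<close>

lemma outer_extension_0: "outer_extension f 0 = exp (complex_of_real (\<integral>w. f w \<partial>\<mu>\<^sub>T))"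
proof -
  have "(\<integral>w. (w + 0) / (w - 0) * complex_of_real (f w) \<partial>\<mu>\<^sub>T) = (\<integral>w. complex_of_real (f w) \<partial>\<mu>\<^sub>T)"
    by (intro Bochner_Integration.integral_cong refl) auto
  then show ?thesis unfolding outer_extension_def by (simp only: integral_complex_of_real)
qed

lemma L1_tendsto_integral_mult:
  fixes G :: "nat \<Rightarrow> complex \<Rightarrow> complex"
  assumes "\<And>j. integrable \<mu>\<^sub>T (G j)" "integrable \<mu>\<^sub>T s" "h \<in> borel_measurable \<mu>\<^sub>T"
    and "AE w in \<mu>\<^sub>T. cmod (h w) \<le> B"
    and "(\<lambda>j. \<integral>w. cmod (G j w - s w) \<partial>\<mu>\<^sub>T) \<longlonglongrightarrow> 0"
  shows "(\<lambda>j. \<integral>w. h w * G j w \<partial>\<mu>\<^sub>T) \<longlonglongrightarrow> (\<integral>w. h w * s w \<partial>\<mu>\<^sub>T)"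
proof (rule LIM_zero_cancel, rule Lim_null_comparison)
  have i: "integrable \<mu>\<^sub>T (\<lambda>w. h w * G j w)" "integrable \<mu>\<^sub>T (\<lambda>w. h w * s w)" for j
    using integrable_circle_mult_bounded[OF assms(1) assms(3,4)] integrable_circle_mult_bounded[OF assms(2-4)]
    by (simp_all add: mult.commute)
  show "\<forall>\<^sub>F j in sequentially. cmod ((\<integral>w. h w * G j w \<partial>\<mu>\<^sub>T) - (\<integral>w. h w * s w \<partial>\<mu>\<^sub>T))
      \<le> B * (\<integral>w. cmod (G j w - s w) \<partial>\<mu>\<^sub>T)"
  proof (intro always_eventually allI)
    fix j
    have "cmod ((\<integral>w. h w * G j w \<partial>\<mu>\<^sub>T) - (\<integral>w. h w * s w \<partial>\<mu>\<^sub>T)) = cmod (\<integral>w. h w * G j w - h w * s w \<partial>\<mu>\<^sub>T)"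
      using i by simp
    also have "\<dots> \<le> (\<integral>w. cmod (h w * G j w - h w * s w) \<partial>\<mu>\<^sub>T)" by (rule integral_norm_bound)
    also have "\<dots> \<le> (\<integral>w. B * cmod (G j w - s w) \<partial>\<mu>\<^sub>T)"
    proof (rule integral_mono_AE)
      show "AE w in \<mu>\<^sub>T. cmod (h w * G j w - h w * s w) \<le> B * cmod (G j w - s w)"
        using assms(4)
      proof eventually_elim
        case (elim w)
        have "cmod (h w * G j w - h w * s w) = cmod (h w) * cmod (G j w - s w)"
          by (simp flip: norm_mult add: algebra_simps)
        with elim show ?case by (simp add: mult_right_mono)
      qed
    qed (use i assms(1,2) in auto)
    also have "\<dots> = B * (\<integral>w. cmod (G j w - s w) \<partial>\<mu>\<^sub>T)" by simp
    finally show "cmod ((\<integral>w. h w * G j w \<partial>\<mu>\<^sub>T) - (\<integral>w. h w * s w \<partial>\<mu>\<^sub>T))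
      \<le> B * (\<integral>w. cmod (G j w - s w) \<partial>\<mu>\<^sub>T)" .
  qed
  show "(\<lambda>j. B * (\<integral>w. cmod (G j w - s w) \<partial>\<mu>\<^sub>T)) \<longlonglongrightarrow> 0"
    using tendsto_mult_left[OF assms(5), of B] by simp
qed

text \<open>Everything is inherited from the dilates: the vanishing coefficients and the Poisson
  formula through integrals against continuous functions, the modulus through almost everywhere
  convergence. The \<open>L^1\<close> convergence stays in the conclusion because the mean of a
  product of two such functions is computed from it.\<close>

lemma outer_function_exists:
  fixes f :: "complex \<Rightarrow> real"
  assumes f: "integrable \<mu>\<^sub>T f" and M: "AE w in \<mu>\<^sub>T. f w \<le> M"
    and r: "\<And>j. 0 \<le> r j" "\<And>j. r j < 1" "r \<longlonglongrightarrow> 1"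
  shows "\<exists>s\<in>Hinf. (AE w in \<mu>\<^sub>T. cmod (s w) = exp (f w)) \<and>
           (\<forall>z\<in>ball 0 1. poisson_integral s z = outer_extension f z) \<and>
           (\<lambda>j. \<integral>w. cmod (outer_extension f (of_real (r j) * w) - s w) \<partial>\<mu>\<^sub>T) \<longlonglongrightarrow> 0"
proof -
  let ?F = "outer_extension f"
  note hol = holomorphic_outer_extension[OF f]
  note bd = cmod_outer_extension_le[OF f M]
  obtain s where s: "s \<in> borel_measurable \<mu>\<^sub>T" "AE w in \<mu>\<^sub>T. cmod (s w) \<le> exp M"
      "(\<lambda>j. \<integral>w. cmod (?F (of_real (r j) * w) - s w) \<partial>\<mu>\<^sub>T) \<longlonglongrightarrow> 0"
    using bounded_holomorphic_radial_limit[OF hol bd r] by blast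
  have si: "integrable \<mu>\<^sub>T s" by (rule circle.integrable_const_bound[OF s(2,1)])
  have Fi: "integrable \<mu>\<^sub>T (\<lambda>w. ?F (of_real (r j) * w))" for j
    by (intro integrable_circle_continuous continuous_on_dilation hol r)
  have lim: "(\<lambda>j. \<integral>w. h w * ?F (of_real (r j) * w) \<partial>\<mu>\<^sub>T) \<longlonglongrightarrow> (\<integral>w. h w * s w \<partial>\<mu>\<^sub>T)"
    if h: "continuous_on (sphere 0 1) h" for h
  proof -
    have "bounded (h ` sphere 0 1)"
      by (intro compact_imp_bounded compact_continuous_image h) auto
    then obtain B where "\<And>w. w \<in> sphere 0 1 \<Longrightarrow> cmod (h w) \<le> B"
      unfolding bounded_iff by blast
    then show ?thesis
      by (intro L1_tendsto_integral_mult[where B = B] Fi si s(3) borel_measurable_circle_continuous h AE_I2) auto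
  qed
  have "s \<in> Linf" using s(1,2) by (auto simp: Linf_def)
  moreover have "(\<integral>w. s w * w ^ n \<partial>\<mu>\<^sub>T) = 0" if "n \<ge> 1" for n
  proof -
    have "(\<lambda>j. \<integral>w. w ^ n * ?F (of_real (r j) * w) \<partial>\<mu>\<^sub>T) \<longlonglongrightarrow> (\<integral>w. w ^ n * s w \<partial>\<mu>\<^sub>T)"
      by (intro lim continuous_intros)
    moreover have "(\<integral>w. w ^ n * ?F (of_real (r j) * w) \<partial>\<mu>\<^sub>T) = 0" for j
      using holomorphic_circle_means(2)[OF hol r(1,2) that] by (simp add: mult.commute)
    ultimately have "(\<integral>w. w ^ n * s w \<partial>\<mu>\<^sub>T) = 0" by (simp add: LIMSEQ_const_iff)
    then show ?thesis by (simp add: mult.commute)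
  qed
  ultimately have "s \<in> Hinf" by (simp add: Hinf_def)
  moreover have "poisson_integral s z = ?F z" if "z \<in> ball 0 1" for z
  proof -
    have z: "cmod z < 1" using that by simp
    have "(\<lambda>j. \<integral>w. of_real (poisson_kernel z w) * ?F (of_real (r j) * w) \<partial>\<mu>\<^sub>T)
        \<longlonglongrightarrow> (\<integral>w. of_real (poisson_kernel z w) * s w \<partial>\<mu>\<^sub>T)"
      by (intro lim continuous_intros continuous_on_poisson_kernel z)
    then have 1: "(\<lambda>j. ?F (of_real (r j) * z)) \<longlonglongrightarrow> poisson_integral s z"
      using holomorphic_circle_means(3)[OF hol r(1,2) z]
      by (simp add: poisson_integral_def poisson_kernel_def)
    have "isCont ?F z"
      using holomorphic_on_imp_continuous_on[OF hol] that by (simp only: continuous_on_eq_continuous_at open_ball)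
    moreover have "(\<lambda>j. of_real (r j) * z) \<longlonglongrightarrow> of_real 1 * z"
      by (intro tendsto_intros r)
    then have "(\<lambda>j. of_real (r j) * z) \<longlonglongrightarrow> z" by simp
    ultimately have "(\<lambda>j. ?F (of_real (r j) * z)) \<longlonglongrightarrow> ?F z"
      by (rule isCont_tendsto_compose)
    with 1 show ?thesis by (rule LIMSEQ_unique)
  qed
  moreover have "AE w in \<mu>\<^sub>T. cmod (s w) = exp (f w)"
  proof -
    let ?P = "\<lambda>j v. \<integral>w. poisson_kernel (of_real (r j) * v) w * f w \<partial>\<mu>\<^sub>T"
    \<comment> \<open>Two nested subsequences: along \<open>p\<close> the Poisson integrals of f
      converge almost everywhere, and along \<open>q\<close> inside it the dilates do, so both
      limits of the modulus are taken along the same radii.\<close>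
    have "\<exists>p. strict_mono p \<and> (AE v in \<mu>\<^sub>T. (\<lambda>k. ?P (p k) v - f v) \<longlonglongrightarrow> 0)"
    proof (rule tendsto_L1_AE_subseq)
      show "integrable \<mu>\<^sub>T (\<lambda>v. ?P j v - f v)" for j
        using poisson_L1_contraction(1)[OF f r(1,2)] f by simp
      show "(\<lambda>j. \<integral>v. norm (?P j v - f v) \<partial>\<mu>\<^sub>T) \<longlonglongrightarrow> 0"
        using poisson_L1_tendsto[OF f r] by simp
    qed
    then obtain p where p: "strict_mono p" "AE v in \<mu>\<^sub>T. (\<lambda>k. ?P (p k) v - f v) \<longlonglongrightarrow> 0" by blast
    have "\<exists>q. strict_mono q \<and> (AE w in \<mu>\<^sub>T. (\<lambda>k. ?F (of_real (r (p (q k))) * w) - s w) \<longlonglongrightarrow> 0)"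
    proof (rule tendsto_L1_AE_subseq)
      show "integrable \<mu>\<^sub>T (\<lambda>w. ?F (of_real (r (p k)) * w) - s w)" for k
        using Fi si by simp
      show "(\<lambda>k. \<integral>w. norm (?F (of_real (r (p k)) * w) - s w) \<partial>\<mu>\<^sub>T) \<longlonglongrightarrow> 0"
        using LIMSEQ_subseq_LIMSEQ[OF s(3) p(1)] by (simp add: o_def)
    qed
    then obtain q where q: "strict_mono q" "AE w in \<mu>\<^sub>T. (\<lambda>k. ?F (of_real (r (p (q k))) * w) - s w) \<longlonglongrightarrow> 0"
      by blast
    show ?thesis
      using p(2) q(2) AE_space
    proof eventually_elim
      case (elim w)
      have "cmod (of_real (r j) * w) < 1" for j using elim(3) r(1)[of j] r(2)[of j] by (simp add: norm_mult)
      then have eq: "cmod (?F (of_real (r j) * w)) = exp (?P j w)" for j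
        by (intro cmod_outer_extension f)
      have "(\<lambda>k. ?P (p (q k)) w) \<longlonglongrightarrow> f w"
        using LIMSEQ_subseq_LIMSEQ[OF LIM_zero_cancel[OF elim(1)] q(1)] by (simp add: o_def)
      then have "(\<lambda>k. exp (?P (p (q k)) w)) \<longlonglongrightarrow> exp (f w)" by (rule tendsto_exp)
      moreover have "(\<lambda>k. cmod (?F (of_real (r (p (q k))) * w))) \<longlonglongrightarrow> cmod (s w)"
        by (intro tendsto_norm LIM_zero_cancel[OF elim(2)])
      ultimately show ?case unfolding eq using LIMSEQ_unique by blast
    qed
  qed
  ultimately show ?thesis using s(3) by blast
qed

section \<open>The mean of a product of boundary functions\<close>

lemma LinfD:
  assumes "h \<in> Linf"
  shows "h \<in> borel_measurable \<mu>\<^sub>T" "\<exists>B. AE w in \<mu>\<^sub>T. cmod (h w) \<le> B" "integrable \<mu>\<^sub>T h"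
  using assms circle.integrable_const_bound[of h] by (auto simp: Linf_def)

text \<open>The dilates of the product F H have mean F 0 * H 0. The factors are replaced by their
  boundary functions one at a time: H under the bound of F, then F under the bound of
  \<open>h\<close>. Both limits run along the same radii \<open>r\<close>.\<close>

lemma integral_mult_boundary_functions:
  assumes s: "s \<in> Linf" "(\<lambda>j. \<integral>w. cmod (F (of_real (r j) * w) - s w) \<partial>\<mu>\<^sub>T) \<longlonglongrightarrow> 0"
    and h: "h \<in> Linf" "(\<lambda>j. \<integral>w. cmod (H (of_real (r j) * w) - h w) \<partial>\<mu>\<^sub>T) \<longlonglongrightarrow> 0"
    and F: "F holomorphic_on ball 0 1" "\<And>z. cmod z < 1 \<Longrightarrow> cmod (F z) \<le> C"
    and H: "H holomorphic_on ball 0 1"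
    and r: "\<And>j. 0 \<le> r j" "\<And>j. r j < 1"
  shows "(\<integral>w. s w * h w \<partial>\<mu>\<^sub>T) = F 0 * H 0"
proof -
  obtain B where B: "AE w in \<mu>\<^sub>T. cmod (h w) \<le> B" using LinfD(2)[OF h(1)] by blast
  let ?F = "\<lambda>j w. F (of_real (r j) * w)" and ?H = "\<lambda>j w. H (of_real (r j) * w)"
  have cont: "continuous_on (sphere 0 1) (?F j)" "continuous_on (sphere 0 1) (?H j)" for j
    by (intro continuous_on_dilation F(1) H r)+
  have int: "integrable \<mu>\<^sub>T (?F j)" "integrable \<mu>\<^sub>T (?H j)" "integrable \<mu>\<^sub>T (\<lambda>w. ?F j w * ?H j w)"
      "integrable \<mu>\<^sub>T (\<lambda>w. ?F j w * h w)" "integrable \<mu>\<^sub>T (\<lambda>w. h w * ?F j w)" for j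
    using cont[of j] integrable_circle_mult_continuous[OF LinfD(3)[OF h(1)] cont(1)]
    by (auto intro!: integrable_circle_continuous continuous_intros simp: mult.commute)
  have "(\<lambda>j. \<integral>w. h w * ?F j w \<partial>\<mu>\<^sub>T) \<longlonglongrightarrow> (\<integral>w. h w * s w \<partial>\<mu>\<^sub>T)"
    by (rule L1_tendsto_integral_mult[OF int(1) LinfD(3)[OF s(1)] LinfD(1)[OF h(1)] B s(2)])
  moreover have "(\<lambda>j. (\<integral>w. ?F j w * ?H j w \<partial>\<mu>\<^sub>T) - (\<integral>w. h w * ?F j w \<partial>\<mu>\<^sub>T)) \<longlonglongrightarrow> 0"
  proof (rule Lim_null_comparison)
    show "(\<lambda>j. C * (\<integral>w. cmod (?H j w - h w) \<partial>\<mu>\<^sub>T)) \<longlonglongrightarrow> 0"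
      using tendsto_mult_left[OF h(2), of C] by simp
    show "\<forall>\<^sub>F j in sequentially. cmod ((\<integral>w. ?F j w * ?H j w \<partial>\<mu>\<^sub>T) - (\<integral>w. h w * ?F j w \<partial>\<mu>\<^sub>T))
        \<le> C * (\<integral>w. cmod (?H j w - h w) \<partial>\<mu>\<^sub>T)"
    proof (intro always_eventually allI)
      fix j
      have "cmod ((\<integral>w. ?F j w * ?H j w \<partial>\<mu>\<^sub>T) - (\<integral>w. h w * ?F j w \<partial>\<mu>\<^sub>T))
          = cmod (\<integral>w. ?F j w * ?H j w - h w * ?F j w \<partial>\<mu>\<^sub>T)"
        using int by simp
      also have "\<dots> \<le> (\<integral>w. cmod (?F j w * ?H j w - h w * ?F j w) \<partial>\<mu>\<^sub>T)"
        by (rule integral_norm_bound)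
      also have "\<dots> \<le> (\<integral>w. C * cmod (?H j w - h w) \<partial>\<mu>\<^sub>T)"
      proof (rule integral_mono)
        fix w assume "w \<in> space \<mu>\<^sub>T"
        then have "cmod (?F j w) \<le> C" using r(1)[of j] r(2)[of j] by (intro F(2)) (simp add: norm_mult)
        moreover have "cmod (?F j w * ?H j w - h w * ?F j w) = cmod (?F j w) * cmod (?H j w - h w)"
          by (simp flip: norm_mult add: algebra_simps)
        ultimately show "cmod (?F j w * ?H j w - h w * ?F j w) \<le> C * cmod (?H j w - h w)"
          by (simp add: mult_right_mono)
      qed (use int LinfD(3)[OF h(1)] in auto)
      finally show "cmod ((\<integral>w. ?F j w * ?H j w \<partial>\<mu>\<^sub>T) - (\<integral>w. h w * ?F j w \<partial>\<mu>\<^sub>T))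
        \<le> C * (\<integral>w. cmod (?H j w - h w) \<partial>\<mu>\<^sub>T)" by simp
    qed
  qed
  ultimately have "(\<lambda>j. (\<integral>w. ?F j w * ?H j w \<partial>\<mu>\<^sub>T)) \<longlonglongrightarrow> (\<integral>w. h w * s w \<partial>\<mu>\<^sub>T)"
    by (rule Lim_transform)
  moreover have "(\<integral>w. ?F j w * ?H j w \<partial>\<mu>\<^sub>T) = F 0 * H 0" for j
    using holomorphic_circle_means(1)[of "\<lambda>z. F z * H z" "r j"] F(1) H r by (simp add: holomorphic_intros)
  ultimately show ?thesis by (simp add: LIMSEQ_const_iff mult.commute)
qed

subsection \<open>Gauge norms and duality\<close>

lemma Linf_of_real_simple:
  fixes s :: "complex \<Rightarrow> real"
  assumes "simple_function \<mu>\<^sub>T s"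
  shows "(\<lambda>z. complex_of_real (s z)) \<in> Linf"
proof -
  have "bounded (s ` space \<mu>\<^sub>T)"
    by (intro finite_imp_bounded simple_functionD(1)[OF assms])
  then obtain B where "\<And>z. z \<in> space \<mu>\<^sub>T \<Longrightarrow> \<bar>s z\<bar> \<le> B"
    unfolding bounded_iff real_norm_def by blast
  then show ?thesis
    using borel_measurable_simple_function[OF assms] by (auto simp: Linf_def intro!: exI[of _ B] AE_I2)
qed

lemma Linf_mult:
  assumes "f \<in> Linf" "g \<in> Linf"
  shows "(\<lambda>z. f z * g z) \<in> Linf"
proof -
  obtain A B where "AE z in \<mu>\<^sub>T. cmod (f z) \<le> A" "AE z in \<mu>\<^sub>T. cmod (g z) \<le> B"
    using LinfD(2)[OF assms(1)] LinfD(2)[OF assms(2)] by blast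
  then have "AE z in \<mu>\<^sub>T. cmod (f z * g z) \<le> A * B"
    by eventually_elim (auto simp: norm_mult intro!: mult_mono intro: order_trans[OF norm_ge_zero])
  then show ?thesis using LinfD(1)[OF assms(1)] LinfD(1)[OF assms(2)] by (auto simp: Linf_def)
qed

lemma Linf_bounded:
  "f \<in> borel_measurable \<mu>\<^sub>T \<Longrightarrow> AE z in \<mu>\<^sub>T. cmod (f z) \<le> B \<Longrightarrow> f \<in> Linf"
  by (auto simp: Linf_def)

lemma Linf_const: "(\<lambda>z. c) \<in> Linf"
  by (rule Linf_bounded[of _ "cmod c"]) auto

lemma ext_norm_mono:
  assumes "AE z in \<mu>\<^sub>T. cmod (f z) \<le> cmod (g z)"
  shows "ext_norm \<beta> f \<le> ext_norm \<beta> g"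
  unfolding ext_norm_def
proof (rule SUP_subset_mono)
  show "{s. simple_function \<mu>\<^sub>T s \<and> (AE z in \<mu>\<^sub>T. 0 \<le> s z \<and> s z \<le> cmod (f z))}
      \<subseteq> {s. simple_function \<mu>\<^sub>T s \<and> (AE z in \<mu>\<^sub>T. 0 \<le> s z \<and> s z \<le> cmod (g z))}"
  proof (intro Collect_mono impI, elim conjE, intro conjI)
    fix s assume "AE z in \<mu>\<^sub>T. 0 \<le> s z \<and> s z \<le> cmod (f z)"
    with assms show "AE z in \<mu>\<^sub>T. 0 \<le> s z \<and> s z \<le> cmod (g z)"
      by eventually_elim auto
  qed
qed simp

context
  fixes \<alpha> :: "(complex \<Rightarrow> complex) \<Rightarrow> real"
  assumes gauge: "normalized_gauge_norm \<alpha>"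
begin

lemma
  shows gauge_nonneg: "f \<in> Linf \<Longrightarrow> 0 \<le> \<alpha> f"
    and gauge_eq_0_iff: "f \<in> Linf \<Longrightarrow> \<alpha> f = 0 \<longleftrightarrow> (AE z in \<mu>\<^sub>T. f z = 0)"
    and gauge_cmult: "f \<in> Linf \<Longrightarrow> \<alpha> (\<lambda>z. c * f z) = cmod c * \<alpha> f"
    and gauge_triangle: "f \<in> Linf \<Longrightarrow> g \<in> Linf \<Longrightarrow> \<alpha> (\<lambda>z. f z + g z) \<le> \<alpha> f + \<alpha> g"
    and gauge_cmod: "f \<in> Linf \<Longrightarrow> \<alpha> (\<lambda>z. complex_of_real (cmod (f z))) = \<alpha> f"
  using gauge unfolding normalized_gauge_norm_def norm_on_Linf_def by blast+

lemma gauge_AE_le: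
  assumes "f \<in> Linf" "g \<in> Linf" "AE z in \<mu>\<^sub>T. f z = g z"
  shows "\<alpha> f \<le> \<alpha> g"
proof -
  have d: "(\<lambda>z. f z - g z) \<in> Linf"
  proof (rule Linf_bounded[of _ 0])
    show "AE z in \<mu>\<^sub>T. cmod (f z - g z) \<le> 0" using assms(3) by eventually_elim simp
  qed (use LinfD(1)[OF assms(1)] LinfD(1)[OF assms(2)] in measurable)
  have "\<alpha> (\<lambda>z. g z + (f z - g z)) \<le> \<alpha> g + \<alpha> (\<lambda>z. f z - g z)"
    by (rule gauge_triangle[OF assms(2) d])
  moreover have "\<alpha> (\<lambda>z. f z - g z) = 0"
    using assms(3) by (simp add: gauge_eq_0_iff[OF d])
  ultimately show ?thesis by simp
qed

lemma gauge_le_if_cmod_eq: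
  assumes "f \<in> Linf" "g \<in> Linf" "AE z in \<mu>\<^sub>T. cmod (f z) = cmod (g z)"
  shows "\<alpha> f \<le> \<alpha> g"
proof -
  have c: "(\<lambda>z. complex_of_real (cmod (h z))) \<in> Linf" if "h \<in> Linf" for h
    using that by (auto simp: Linf_def)
  have "\<alpha> (\<lambda>z. complex_of_real (cmod (f z))) \<le> \<alpha> (\<lambda>z. complex_of_real (cmod (g z)))"
    using assms(3) by (intro gauge_AE_le c assms(1,2)) simp
  then show ?thesis by (simp add: gauge_cmod assms(1,2))
qed

text \<open>
  A number \<open>t\<close> in \<open>[0, 1]\<close> is the mean of the unimodular numbers \<open>t \<plusminus> \<i> \<surd>(1 - t\<^sup>2)\<close>, and \<open>\<alpha>\<close> does
  not see unimodular factors.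
\<close>

lemma gauge_mono:
  assumes f: "f \<in> Linf" and g: "g \<in> Linf" and le: "AE z in \<mu>\<^sub>T. cmod (f z) \<le> cmod (g z)"
  shows "\<alpha> f \<le> \<alpha> g"
proof -
  note [measurable] = LinfD(1)[OF f] LinfD(1)[OF g]
  \<comment> \<open>The minimum gives t <= 1 at every point, so the square root below is that of a
    nonnegative number. Where \<open>g z = 0\<close> the quotient is 0 by convention, and
    \<open>f z = 0\<close> at almost every such point.\<close>
  define t where "t z = min 1 (cmod (f z) / cmod (g z))" for z
  define v where "v \<sigma> z = Complex (t z) (\<sigma> * sqrt (1 - (t z)\<^sup>2))" for \<sigma> :: real and z
  have t: "0 \<le> t z" "t z \<le> 1" for z by (auto simp: t_def)
  have v1: "cmod (v \<sigma> z) = 1" if "\<sigma>\<^sup>2 = 1" for \<sigma> z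
    using t[of z] that by (simp add: v_def cmod_def power_mult_distrib abs_square_le_1)
  have vm: "v \<sigma> \<in> borel_measurable \<mu>\<^sub>T" for \<sigma>
    unfolding v_def t_def complex_eq_iff Complex_eq by measurable
  have vg: "(\<lambda>z. v \<sigma> z * g z) \<in> Linf" "\<alpha> (\<lambda>z. v \<sigma> z * g z) \<le> \<alpha> g" if "\<sigma>\<^sup>2 = 1" for \<sigma>
  proof -
    show "(\<lambda>z. v \<sigma> z * g z) \<in> Linf"
      by (intro Linf_mult Linf_bounded[of _ 1] vm g) (simp add: v1[OF that])
    then show "\<alpha> (\<lambda>z. v \<sigma> z * g z) \<le> \<alpha> g"
      by (intro gauge_le_if_cmod_eq g) (simp_all add: norm_mult v1[OF that])
  qed
  have sum: "v 1 z * g z + v (- 1) z * g z = 2 * (complex_of_real (t z) * g z)" for z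
  proof -
    have "v 1 z + v (- 1) z = 2 * complex_of_real (t z)"
      by (simp add: v_def complex_eq_iff)
    then show ?thesis
      by (simp flip: distrib_right)
  qed
  have L: "(\<lambda>z. v 1 z * g z + v (- 1) z * g z) \<in> Linf" "(\<lambda>z. complex_of_real (t z) * g z) \<in> Linf"
  proof -
    show "(\<lambda>z. complex_of_real (t z) * g z) \<in> Linf"
      by (intro Linf_mult Linf_bounded[of _ 1] g) (use t in \<open>auto simp: t_def\<close>)
    from Linf_mult[OF Linf_const[of 2] this]
    show "(\<lambda>z. v 1 z * g z + v (- 1) z * g z) \<in> Linf"
      unfolding sum .
  qed
  have "\<alpha> f \<le> \<alpha> (\<lambda>z. complex_of_real (t z) * g z)"
  proof (rule gauge_le_if_cmod_eq[OF f L(2)])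
    show "AE z in \<mu>\<^sub>T. cmod (f z) = cmod (complex_of_real (t z) * g z)"
      using le
    proof eventually_elim
      case (elim z)
      then show ?case by (cases "g z = 0") (auto simp: t_def norm_mult norm_divide divide_le_eq_1)
    qed
  qed
  also have "\<dots> = \<alpha> (\<lambda>z. (1 / 2) * (v 1 z * g z + v (- 1) z * g z))" unfolding sum by simp
  also have "\<dots> = (1 / 2) * \<alpha> (\<lambda>z. v 1 z * g z + v (- 1) z * g z)" by (subst gauge_cmult[OF L(1)]) simp
  also have "\<dots> \<le> (1 / 2) * (\<alpha> (\<lambda>z. v 1 z * g z) + \<alpha> (\<lambda>z. v (- 1) z * g z))"
    by (intro mult_left_mono gauge_triangle vg) auto
  also have "\<dots> \<le> \<alpha> g" using vg(2)[of 1] vg(2)[of "- 1"] by simp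
  finally show ?thesis .
qed

section \<open>The extended norm and the space \<open>Lspace\<close>\<close>

lemma ext_norm_Linf_le:
  assumes "f \<in> Linf"
  shows "ext_norm \<alpha> f \<le> ennreal (\<alpha> f)"
  unfolding ext_norm_def
proof (rule SUP_least, clarify)
  fix s :: "complex \<Rightarrow> real"
  assume s: "simple_function \<mu>\<^sub>T s" "AE z in \<mu>\<^sub>T. 0 \<le> s z \<and> s z \<le> cmod (f z)"
  have "AE z in \<mu>\<^sub>T. cmod (complex_of_real (s z)) \<le> cmod (f z)" using s(2) by eventually_elim simp
  then show "ennreal (\<alpha> (\<lambda>z. complex_of_real (s z))) \<le> ennreal (\<alpha> f)"
    by (intro ennreal_leI gauge_mono Linf_of_real_simple s(1) assms)
qed

lemma Linf_subset_Lspace: "Linf \<subseteq> Lspace \<alpha>"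
proof
  fix f assume f: "f \<in> Linf"
  have "ext_norm \<alpha> f < \<infinity>"
    using ext_norm_Linf_le[OF f] by (simp add: le_less_trans)
  then have "f \<in> calL \<alpha>" using LinfD(1)[OF f] by (simp add: calL_def)
  moreover have "ext_norm \<alpha> (\<lambda>z. f z - f z) < e" if "e > 0" for e
  proof -
    have "\<alpha> (\<lambda>z. 0) = 0" using gauge_eq_0_iff[OF Linf_const[of 0]] by simp
    then show ?thesis using ext_norm_Linf_le[OF Linf_const[of 0]] that by simp
  qed
  ultimately show "f \<in> Lspace \<alpha>" using f unfolding Lspace_def by blast
qed

text \<open>Almost everywhere h = u f with \<open>u\<close> unimodular, and if \<open>g\<close>
  approximates f then u g approximates h equally well. This carries membership from
  \<open>1/k\<close> to \<open>1/s\<close>.\<close>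

lemma Lspace_cong_cmod:
  assumes f: "f \<in> Lspace \<alpha>" and h: "h \<in> borel_measurable \<mu>\<^sub>T"
    and eq: "AE z in \<mu>\<^sub>T. cmod (h z) = cmod (f z)"
  shows "h \<in> Lspace \<alpha>"
proof -
  have fm [measurable]: "f \<in> borel_measurable \<mu>\<^sub>T" and fin: "ext_norm \<alpha> f < \<infinity>"
    using f by (auto simp: Lspace_def calL_def)
  note h [measurable]
  have "ext_norm \<alpha> h \<le> ext_norm \<alpha> f"
    using eq by (intro ext_norm_mono) (auto elim: eventually_mono)
  then have "h \<in> calL \<alpha>" using h fin by (auto simp: calL_def)
  \<comment> \<open>The value 1 on the zeros of f keeps \<open>u\<close> unimodular there.\<close>
  define u where "u z = (if f z = 0 then 1 else h z / f z)" for z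
  have um: "u \<in> borel_measurable \<mu>\<^sub>T" unfolding u_def by measurable
  have u: "AE z in \<mu>\<^sub>T. cmod (u z) = 1 \<and> h z = u z * f z"
    using eq by eventually_elim (auto simp: u_def norm_divide)
  have uL: "u \<in> Linf" using u by (intro Linf_bounded[OF um, of 1]) (auto elim: eventually_mono)
  have "\<exists>g\<in>Linf. ext_norm \<alpha> (\<lambda>z. h z - g z) < e" if e: "e > 0" for e
  proof -
    obtain g where g: "g \<in> Linf" "ext_norm \<alpha> (\<lambda>z. f z - g z) < e"
      using f e unfolding Lspace_def by blast
    have "ext_norm \<alpha> (\<lambda>z. h z - u z * g z) \<le> ext_norm \<alpha> (\<lambda>z. f z - g z)"
    proof (rule ext_norm_mono)
      show "AE z in \<mu>\<^sub>T. cmod (h z - u z * g z) \<le> cmod (f z - g z)"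
        using u
      proof eventually_elim
        case (elim z)
        then have "h z - u z * g z = u z * (f z - g z)" by (simp add: algebra_simps)
        then show ?case using elim by (simp add: norm_mult)
      qed
    qed
    then show ?thesis
      by (intro bexI[OF _ Linf_mult[OF uL g(1)]] le_less_trans[OF _ g(2)])
  qed
  with \<open>h \<in> calL \<alpha>\<close> show ?thesis unfolding Lspace_def by blast
qed

section \<open>Hoelder's inequality and the weak topology\<close>

context
  assumes dom: "L1_dominating \<alpha>"
begin

text \<open>The integral is at most C times the \<open>L^1\<close> norm of \<open>h\<close>, which
  domination bounds by 1 / c. So the supremum in \<open>dual_norm\<close> is over a bounded set. One
  \<open>c\<close> serves all \<tau>, which bounds the dual norms of all simple functions between 0
  and 1 at once.\<close>

lemma dual_pairing_bounded:
  "\<exists>c>0. \<forall>\<tau> C h. \<tau> \<in> borel_measurable \<mu>\<^sub>T \<longrightarrow> (AE z in \<mu>\<^sub>T. cmod (\<tau> z) \<le> C) \<longrightarrow> 0 \<le> C \<longrightarrow>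
      h \<in> Linf \<longrightarrow> \<alpha> h \<le> 1 \<longrightarrow> cmod (\<integral>z. \<tau> z * h z \<partial>\<mu>\<^sub>T) \<le> C / c"
proof -
  obtain c where c: "c > 0" "\<And>f. f \<in> Linf \<Longrightarrow> \<alpha> f \<ge> c * (\<integral>z. cmod (f z) \<partial>\<mu>\<^sub>T)"
    using dom by (auto simp: L1_dominating_def)
  have "cmod (\<integral>z. \<tau> z * h z \<partial>\<mu>\<^sub>T) \<le> C / c"
    if \<tau>: "\<tau> \<in> borel_measurable \<mu>\<^sub>T" "AE z in \<mu>\<^sub>T. cmod (\<tau> z) \<le> C" "0 \<le> C" and h: "h \<in> Linf" "\<alpha> h \<le> 1"
    for \<tau> C h
  proof -
    have int: "integrable \<mu>\<^sub>T (\<lambda>z. \<tau> z * h z)"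
      using integrable_circle_mult_bounded[OF LinfD(3)[OF h(1)] \<tau>(1,2)] by (simp add: mult.commute)
    have "cmod (\<integral>z. \<tau> z * h z \<partial>\<mu>\<^sub>T) \<le> (\<integral>z. cmod (\<tau> z * h z) \<partial>\<mu>\<^sub>T)"
      by (rule integral_norm_bound)
    also have "\<dots> \<le> (\<integral>z. C * cmod (h z) \<partial>\<mu>\<^sub>T)"
    proof (rule integral_mono_AE)
      show "AE z in \<mu>\<^sub>T. cmod (\<tau> z * h z) \<le> C * cmod (h z)"
        using \<tau>(2) by eventually_elim (simp add: norm_mult mult_right_mono)
    qed (use int LinfD(3)[OF h(1)] in auto)
    also have "\<dots> = C * (\<integral>z. cmod (h z) \<partial>\<mu>\<^sub>T)" by simp
    also have "\<dots> \<le> C * (1 / c)"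
    proof (intro mult_left_mono \<tau>(3))
      have "c * (\<integral>z. cmod (h z) \<partial>\<mu>\<^sub>T) \<le> 1" using c(2)[OF h(1)] h(2) by linarith
      then show "(\<integral>z. cmod (h z) \<partial>\<mu>\<^sub>T) \<le> 1 / c" using c(1) by (simp add: field_simps)
    qed
    finally show ?thesis by simp
  qed
  with c(1) show ?thesis by blast
qed

text \<open>Scaling \<sigma> to norm 1 makes the pairing a member of the set under the supremum; if
  \<alpha> \<sigma> = 0, definiteness makes both sides 0.\<close>

lemma dual_pairing_le:
  assumes \<sigma>: "\<sigma> \<in> Linf" and \<tau>: "\<tau> \<in> Linf"
  shows "cmod (\<integral>z. \<tau> z * \<sigma> z \<partial>\<mu>\<^sub>T) \<le> \<alpha> \<sigma> * dual_norm \<alpha> \<tau>"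
proof (cases "\<alpha> \<sigma> = 0")
  case True
  then have "AE z in \<mu>\<^sub>T. \<sigma> z = 0" using gauge_eq_0_iff[OF \<sigma>] by simp
  then have "AE z in \<mu>\<^sub>T. \<tau> z * \<sigma> z = 0" by eventually_elim simp
  then show ?thesis using True by (simp add: integral_eq_zero_AE)
next
  case False
  then have pos: "\<alpha> \<sigma> > 0" using gauge_nonneg[OF \<sigma>] by simp
  let ?h = "\<lambda>z. complex_of_real (1 / \<alpha> \<sigma>) * \<sigma> z"
  let ?S = "{cmod (\<integral>z. \<tau> z * h z \<partial>\<mu>\<^sub>T) | h. h \<in> Linf \<and> \<alpha> h \<le> 1}"
  have h: "?h \<in> Linf" "\<alpha> ?h = 1"
  proof -
    show "?h \<in> Linf" by (rule Linf_mult[OF Linf_const \<sigma>])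
    show "\<alpha> ?h = 1" unfolding gauge_cmult[OF \<sigma>] using pos by (simp add: norm_divide)
  qed
  obtain C where "AE z in \<mu>\<^sub>T. cmod (\<tau> z) \<le> C" using LinfD(2)[OF \<tau>] by blast
  then have C: "AE z in \<mu>\<^sub>T. cmod (\<tau> z) \<le> max C 0" by eventually_elim auto
  obtain c where c: "\<And>\<tau> C h. \<tau> \<in> borel_measurable \<mu>\<^sub>T \<Longrightarrow> (AE z in \<mu>\<^sub>T. cmod (\<tau> z) \<le> C) \<Longrightarrow> 0 \<le> C \<Longrightarrow>
      h \<in> Linf \<Longrightarrow> \<alpha> h \<le> 1 \<Longrightarrow> cmod (\<integral>z. \<tau> z * h z \<partial>\<mu>\<^sub>T) \<le> C / c"
    using dual_pairing_bounded by blast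
  have "bdd_above ?S"
    using c[OF LinfD(1)[OF \<tau>] C] by (intro bdd_aboveI[of _ "max C 0 / c"]) auto
  then have "cmod (\<integral>z. \<tau> z * ?h z \<partial>\<mu>\<^sub>T) \<le> dual_norm \<alpha> \<tau>"
    unfolding dual_norm_def
    by (rule cSup_upper[rotated]) (intro CollectI exI[of _ ?h], use h in simp)
  moreover have "(\<integral>z. \<tau> z * ?h z \<partial>\<mu>\<^sub>T) = complex_of_real (1 / \<alpha> \<sigma>) * (\<integral>z. \<tau> z * \<sigma> z \<partial>\<mu>\<^sub>T)"
    by (subst integral_mult_right_zero[symmetric]) (simp add: mult_ac)
  ultimately show ?thesis using pos by (simp add: norm_divide field_simps)
qed

text \<open>The constant 1 as a dual element has two uses: it makes \<open>1/k\<close> integrable,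
  and it makes the generators of the weak topology cover all of \<open>Lspace\<close>.\<close>

lemma one_in_calL_dual: "(\<lambda>z. 1) \<in> calL (dual_norm \<alpha>)"
proof -
  obtain c where c: "c > 0" "\<And>\<tau> C h. \<tau> \<in> borel_measurable \<mu>\<^sub>T \<Longrightarrow> (AE z in \<mu>\<^sub>T. cmod (\<tau> z) \<le> C) \<Longrightarrow> 0 \<le> C \<Longrightarrow>
      h \<in> Linf \<Longrightarrow> \<alpha> h \<le> 1 \<Longrightarrow> cmod (\<integral>z. \<tau> z * h z \<partial>\<mu>\<^sub>T) \<le> C / c"
    using dual_pairing_bounded by blast
  have z: "\<alpha> (\<lambda>z. 0) = 0" using gauge_eq_0_iff[OF Linf_const[of 0]] by simp
  have "ext_norm (dual_norm \<alpha>) (\<lambda>z. 1) \<le> ennreal (1 / c)"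
    unfolding ext_norm_def
  proof (rule SUP_least, clarify)
    fix s :: "complex \<Rightarrow> real"
    assume s: "simple_function \<mu>\<^sub>T s" "AE z in \<mu>\<^sub>T. 0 \<le> s z \<and> s z \<le> cmod 1"
    have "AE z in \<mu>\<^sub>T. cmod (complex_of_real (s z)) \<le> 1" using s(2) by eventually_elim auto
    then have "cmod (\<integral>z. complex_of_real (s z) * h z \<partial>\<mu>\<^sub>T) \<le> 1 / c" if "h \<in> Linf" "\<alpha> h \<le> 1" for h
      using that by (intro c(2) LinfD(1)[OF Linf_of_real_simple[OF s(1)]]) auto
    \<comment> \<open>\<open>cSup_least\<close> asks for a nonempty set; the zero function is
      admissible.\<close>
    moreover have "{cmod (\<integral>z. complex_of_real (s z) * h z \<partial>\<mu>\<^sub>T) | h. h \<in> Linf \<and> \<alpha> h \<le> 1} \<noteq> {}"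
      using Linf_const[of 0] z by (auto intro!: exI[of _ "\<lambda>z. 0"])
    ultimately have "dual_norm \<alpha> (\<lambda>z. complex_of_real (s z)) \<le> 1 / c"
      unfolding dual_norm_def by (intro cSup_least) auto
    then show "ennreal (dual_norm \<alpha> (\<lambda>z. complex_of_real (s z))) \<le> ennreal (1 / c)"
      by (rule ennreal_leI)
  qed
  then show ?thesis by (simp add: calL_def le_less_trans)
qed

text \<open>Hoelder's inequality holds for simple minorants, whose norms are bounded by the extended
  norms by definition; Fatou's lemma passes it to f and g.\<close>

lemma dual_pairing_integrable:
  assumes f: "f \<in> calL \<alpha>" and g: "g \<in> calL (dual_norm \<alpha>)"
  shows "integrable \<mu>\<^sub>T (\<lambda>z. f z * g z)"
proof (rule integrableI_bounded)
  have fm [measurable]: "f \<in> borel_measurable \<mu>\<^sub>T" and gm [measurable]: "g \<in> borel_measurable \<mu>\<^sub>T"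
    and fin: "ext_norm \<alpha> f < \<infinity>" "ext_norm (dual_norm \<alpha>) g < \<infinity>"
    using f g by (auto simp: calL_def)
  show "(\<lambda>z. f z * g z) \<in> borel_measurable \<mu>\<^sub>T" by measurable
  \<comment> \<open>The simple approximations \<open>F i\<close> satisfy |F i| <= 2 |h|. Half their
    modulus lies below |h|, as \<open>ext_norm\<close> requires, at the price of the limit |h| / 2;
    the two halves account for the factor 4 at the end.\<close>
  have approx: "\<exists>\<sigma>. (\<forall>i. simple_function \<mu>\<^sub>T (\<sigma> i)) \<and>
      (\<forall>i. \<forall>z\<in>space \<mu>\<^sub>T. 0 \<le> \<sigma> i z \<and> \<sigma> i z \<le> cmod (h z)) \<and>
      (\<forall>z\<in>space \<mu>\<^sub>T. (\<lambda>i::nat. \<sigma> i z) \<longlonglongrightarrow> cmod (h z) / 2)"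
    if h: "h \<in> borel_measurable \<mu>\<^sub>T" for h :: "complex \<Rightarrow> complex"
  proof -
    obtain F where F: "\<And>i. simple_function \<mu>\<^sub>T (F i)"
        "\<And>z. z \<in> space \<mu>\<^sub>T \<Longrightarrow> (\<lambda>i. F i z) \<longlonglongrightarrow> h z"
        "\<And>i z. z \<in> space \<mu>\<^sub>T \<Longrightarrow> dist (F i z) 0 \<le> 2 * dist (h z) 0"
      using borel_measurable_implies_sequence_metric[OF h, of 0] by blast
    show ?thesis
    proof (intro exI[of _ "\<lambda>i z. cmod (F i z) / 2"] conjI allI ballI)
      show "simple_function \<mu>\<^sub>T (\<lambda>z. cmod (F i z) / 2)" for i
        using simple_function_compose1[OF F(1)[of i], of "\<lambda>x. cmod x / 2"] by simp
      show "cmod (F i z) / 2 \<le> cmod (h z)" if "z \<in> space \<mu>\<^sub>T" for i z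
        using F(3)[OF that, of i] by simp
      show "(\<lambda>i. cmod (F i z) / 2) \<longlonglongrightarrow> cmod (h z) / 2" if "z \<in> space \<mu>\<^sub>T" for z
        by (intro tendsto_intros F(2)[OF that]) simp
    qed simp
  qed
  obtain \<sigma> where \<sigma>: "\<And>i. simple_function \<mu>\<^sub>T (\<sigma> i)"
      "\<And>i z. z \<in> space \<mu>\<^sub>T \<Longrightarrow> 0 \<le> \<sigma> i z \<and> \<sigma> i z \<le> cmod (f z)"
      "\<And>z. z \<in> space \<mu>\<^sub>T \<Longrightarrow> (\<lambda>i. \<sigma> i z) \<longlonglongrightarrow> cmod (f z) / 2"
    using approx[OF fm] by blast
  obtain \<tau> where \<tau>: "\<And>i. simple_function \<mu>\<^sub>T (\<tau> i)"
      "\<And>i z. z \<in> space \<mu>\<^sub>T \<Longrightarrow> 0 \<le> \<tau> i z \<and> \<tau> i z \<le> cmod (g z)"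
      "\<And>z. z \<in> space \<mu>\<^sub>T \<Longrightarrow> (\<lambda>i. \<tau> i z) \<longlonglongrightarrow> cmod (g z) / 2"
    using approx[OF gm] by blast
  note [measurable] = borel_measurable_simple_function[OF \<sigma>(1)] borel_measurable_simple_function[OF \<tau>(1)]
  let ?E = "ext_norm \<alpha> f * ext_norm (dual_norm \<alpha>) g"
  have bound: "(\<integral>\<^sup>+z. ennreal (\<sigma> i z * \<tau> i z) \<partial>\<mu>\<^sub>T) \<le> ?E" for i
  proof -
    let ?s = "\<lambda>z. complex_of_real (\<sigma> i z)" and ?t = "\<lambda>z. complex_of_real (\<tau> i z)"
    have L: "?s \<in> Linf" "?t \<in> Linf" by (intro Linf_of_real_simple \<sigma>(1) \<tau>(1))+
    have "integrable \<mu>\<^sub>T (\<lambda>z. complex_of_real (\<tau> i z * \<sigma> i z))"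
      using LinfD(3)[OF Linf_mult[OF L(2,1)]] by simp
    then have int: "integrable \<mu>\<^sub>T (\<lambda>z. \<tau> i z * \<sigma> i z)" by (rule complex_of_real_integrable_eq[THEN iffD1])
    have "(\<integral>\<^sup>+z. ennreal (\<sigma> i z * \<tau> i z) \<partial>\<mu>\<^sub>T) = (\<integral>\<^sup>+z. ennreal (\<tau> i z * \<sigma> i z) \<partial>\<mu>\<^sub>T)"
      by (simp add: mult.commute)
    also have "\<dots> = ennreal (\<integral>z. \<tau> i z * \<sigma> i z \<partial>\<mu>\<^sub>T)"
      using \<sigma>(2) \<tau>(2) by (intro nn_integral_eq_integral int AE_I2) auto
    also have "(\<integral>z. \<tau> i z * \<sigma> i z \<partial>\<mu>\<^sub>T) \<le> cmod (\<integral>z. ?t z * ?s z \<partial>\<mu>\<^sub>T)"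
      by (simp flip: of_real_mult)
    also have "\<dots> \<le> \<alpha> ?s * dual_norm \<alpha> ?t" by (rule dual_pairing_le[OF L])
    also have "ennreal \<dots> = ennreal (\<alpha> ?s) * ennreal (dual_norm \<alpha> ?t)"
      by (rule ennreal_mult'[OF gauge_nonneg[OF L(1)]])
    also have "\<dots> \<le> ?E"
    proof (rule mult_mono)
      show "ennreal (\<alpha> ?s) \<le> ext_norm \<alpha> f"
        unfolding ext_norm_def using \<sigma> by (intro SUP_upper) auto
      show "ennreal (dual_norm \<alpha> ?t) \<le> ext_norm (dual_norm \<alpha>) g"
        unfolding ext_norm_def using \<tau> by (intro SUP_upper) auto
    qed auto
    finally show ?thesis by (simp add: ennreal_leI)
  qed
  have "(\<integral>\<^sup>+z. ennreal (cmod (f z * g z) / 4) \<partial>\<mu>\<^sub>T) = (\<integral>\<^sup>+z. liminf (\<lambda>i. ennreal (\<sigma> i z * \<tau> i z)) \<partial>\<mu>\<^sub>T)"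
  proof (intro nn_integral_cong)
    fix z assume z: "z \<in> space \<mu>\<^sub>T"
    have "(\<lambda>i. ennreal (\<sigma> i z * \<tau> i z)) \<longlonglongrightarrow> ennreal (cmod (f z) / 2 * (cmod (g z) / 2))"
      by (intro tendsto_ennrealI tendsto_mult \<sigma>(3) \<tau>(3) z)
    then show "ennreal (cmod (f z * g z) / 4) = liminf (\<lambda>i. ennreal (\<sigma> i z * \<tau> i z))"
      by (simp add: lim_imp_Liminf norm_mult)
  qed
  also have "\<dots> \<le> liminf (\<lambda>i. \<integral>\<^sup>+z. ennreal (\<sigma> i z * \<tau> i z) \<partial>\<mu>\<^sub>T)"
    by (rule nn_integral_liminf) measurable
  also have "\<dots> \<le> liminf (\<lambda>i::nat. ?E)"
    by (rule Liminf_mono) (simp add: bound)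
  also have "\<dots> = ?E" by (simp add: Liminf_const)
  finally have le: "(\<integral>\<^sup>+z. ennreal (cmod (f z * g z) / 4) \<partial>\<mu>\<^sub>T) \<le> ?E" .
  have "(\<integral>\<^sup>+z. ennreal (cmod (f z * g z)) \<partial>\<mu>\<^sub>T) = (\<integral>\<^sup>+z. 4 * ennreal (cmod (f z * g z) / 4) \<partial>\<mu>\<^sub>T)"
    by (intro nn_integral_cong) (simp flip: ennreal_numeral ennreal_mult')
  also have "\<dots> = 4 * (\<integral>\<^sup>+z. ennreal (cmod (f z * g z) / 4) \<partial>\<mu>\<^sub>T)"
    by (rule nn_integral_cmult) measurable
  also have "\<dots> \<le> 4 * ?E" by (intro mult_left_mono le) simp
  also have "\<dots> < \<infinity>" using fin by (simp add: ennreal_mult_less_top)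
  finally show "(\<integral>\<^sup>+z. ennreal (cmod (f z * g z)) \<partial>\<mu>\<^sub>T) < \<infinity>" .
qed

text \<open>Convergence under every functional puts the sequence eventually into each generator that
  contains \<open>x\<close>. This property survives finite intersections and arbitrary unions, hence
  holds for all open sets.\<close>

lemma weak_closure_sequential:
  assumes x: "x \<in> Lspace \<alpha>" and y: "\<And>n. y n \<in> Hinf"
    and lim: "\<And>g. g \<in> calL (dual_norm \<alpha>) \<Longrightarrow> (\<lambda>n::nat. \<integral>z. y n z * g z \<partial>\<mu>\<^sub>T) \<longlonglongrightarrow> (\<integral>z. x z * g z \<partial>\<mu>\<^sub>T)"
  shows "x \<in> Hspace \<alpha>"
proof -
  let ?S = "{{f \<in> Lspace \<alpha>. (\<integral>z. f z * g z \<partial>\<mu>\<^sub>T) \<in> U} | g U. g \<in> calL (dual_norm \<alpha>) \<and> open U}"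
  have yL: "y n \<in> Lspace \<alpha>" for n
    using y[of n] Linf_subset_Lspace by (auto simp: Hinf_def)
  have ev: "x \<in> T \<longrightarrow> (\<forall>\<^sub>F n in sequentially. y n \<in> T)" if "generate_topology_on ?S T" for T
    using that
  proof induction
    case (Int a b)
    then show ?case by (auto intro: eventually_conj)
  next
    case (UN K)
    show ?case
    proof
      assume "x \<in> \<Union>K"
      then obtain X where "X \<in> K" "x \<in> X" by blast
      with UN.IH have "\<forall>\<^sub>F n in sequentially. y n \<in> X" by blast
      then show "\<forall>\<^sub>F n in sequentially. y n \<in> \<Union>K"
        by eventually_elim (use \<open>X \<in> K\<close> in blast)
    qed
  next
    case (Basis T)
    then obtain g U where gU: "g \<in> calL (dual_norm \<alpha>)" "open U"
        and T: "T = {f \<in> Lspace \<alpha>. (\<integral>z. f z * g z \<partial>\<mu>\<^sub>T) \<in> U}" by blast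
    show ?case
      using topological_tendstoD[OF lim[OF gU(1)] gU(2)] yL by (auto simp: T)
  qed simp
  \<comment> \<open>The underlying set of the topology is the union of its generators; the
    functional of g = 1 with \<open>U = UNIV\<close> yields the whole of
    \<open>Lspace\<close>.\<close>
  have "{f \<in> Lspace \<alpha>. (\<integral>z. f z * 1 \<partial>\<mu>\<^sub>T) \<in> UNIV} \<in> ?S"
    using one_in_calL_dual by (intro CollectI exI[of _ "\<lambda>z. 1"] exI[of _ UNIV]) auto
  then have "x \<in> \<Union>?S" using x by (intro UnionI) auto
  then have "x \<in> topspace (weak_topology \<alpha>)"
    unfolding weak_topology_def topology_generated_by_topspace .
  moreover have "\<exists>n. y n \<in> T" if "x \<in> T" "openin (weak_topology \<alpha>) T" for T
    using ev[of T] that eventually_happens[of _ sequentially]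
    unfolding weak_topology_def openin_topology_generated_by_iff by auto
  ultimately show ?thesis unfolding Hspace_def in_closure_of using y by blast
qed

end

end

subsection \<open>The factorization\<close>

text \<open>Since \<open>1 / 0 = 0\<close> in HOL, the existence of the reciprocal of
  \<open>k\<close> is expressed by \<open>k\<close> being nonzero almost everywhere.\<close>

theorem theorem3p5:
  fixes \<alpha> :: "(complex \<Rightarrow> complex) \<Rightarrow> real" and k :: "complex \<Rightarrow> complex"
  assumes "normalized_gauge_norm \<alpha>" and "L1_dominating \<alpha>"
    and "k \<in> Linf" and "AE z in \<mu>\<^sub>T. k z \<noteq> 0" and "(\<lambda>z. 1 / k z) \<in> Lspace \<alpha>"
  shows "\<exists>u s. u \<in> Linf \<and> unimodular u \<and> s \<in> Hinf \<and> outer s \<and>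
           (AE z in \<mu>\<^sub>T. k z = u z * s z) \<and> (\<lambda>z. 1 / s z) \<in> Hspace \<alpha>"
proof -
  note k0 = assms(4)
  have km [measurable]: "k \<in> borel_measurable \<mu>\<^sub>T" using assms(3) by (rule LinfD)
  obtain C where C: "AE z in \<mu>\<^sub>T. cmod (k z) \<le> C" using LinfD(2)[OF assms(3)] by blast
  have kinv: "(\<lambda>z. 1 / k z) \<in> calL \<alpha>" using assms(5) by (simp add: Lspace_def)
  have kinv_int: "integrable \<mu>\<^sub>T (\<lambda>z. 1 / k z)"
    using dual_pairing_integrable[OF assms(1,2) kinv one_in_calL_dual[OF assms(1,2)]] by simp

  define f where "f z = ln (cmod (k z))" for z
  have fm [measurable]: "f \<in> borel_measurable \<mu>\<^sub>T" unfolding f_def by measurable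
  have ln_le: "ln x \<le> x" if "x > 0" for x :: real
    using ln_le_minus_one[OF that] by linarith
  have fC: "AE z in \<mu>\<^sub>T. f z \<le> C"
    using k0 C
  proof eventually_elim
    case (elim z)
    then show ?case using ln_le[of "cmod (k z)"] by (simp add: f_def)
  qed
  \<comment> \<open>Bounded above by \<open>C\<close> and below by -|1/k|, because ln x <= x for
    positive x.\<close>
  have f: "integrable \<mu>\<^sub>T f"
  proof (rule Bochner_Integration.integrable_bound)
    show "integrable \<mu>\<^sub>T (\<lambda>z. \<bar>C\<bar> + cmod (1 / k z))" using kinv_int by simp
    show "AE z in \<mu>\<^sub>T. norm (f z) \<le> norm (\<bar>C\<bar> + cmod (1 / k z))"
      using fC k0
    proof eventually_elim
      case (elim z)
      have "- f z = ln (cmod (1 / k z))" using elim by (simp add: f_def norm_divide ln_div)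
      also have "\<dots> \<le> cmod (1 / k z)" using elim by (intro ln_le) simp
      finally have "- f z \<le> cmod (1 / k z)" .
      moreover have "0 \<le> cmod (1 / k z)" by simp
      ultimately have "\<bar>f z\<bar> \<le> \<bar>C\<bar> + cmod (1 / k z)" using elim(1) by linarith
      then show ?case by simp
    qed
  qed simp
  \<comment> \<open>The logarithm of min (1/|k|, exp n), almost everywhere. As n >= 0, truncation
    does not increase the absolute value, so |f| is an integrable majorant for every n.\<close>
  define g where "g n z = min (- f z) (real n)" for n z
  have gi: "integrable \<mu>\<^sub>T (g n)" for n
  proof (rule Bochner_Integration.integrable_bound)
    show "integrable \<mu>\<^sub>T (\<lambda>z. \<bar>f z\<bar>)" using f by simp
    show "AE z in \<mu>\<^sub>T. norm (g n z) \<le> norm \<bar>f z\<bar>" by (intro AE_I2) (auto simp: g_def)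
  qed (simp add: g_def[abs_def])

  \<comment> \<open>One sequence of radii serves \<open>s\<close> and all \<open>h n\<close>, since
    the formula for the mean of a product compares both factors along the same dilates.\<close>
  define r where "r j = 1 - inverse (real (Suc j))" for j
  have r: "0 \<le> r j" "r j < 1" "r \<longlonglongrightarrow> 1" for j
    using tendsto_diff[OF tendsto_const[of "1 :: real"] LIMSEQ_inverse_real_of_nat]
    by (auto simp: r_def[abs_def] inverse_le_1_iff)

  obtain s where s: "s \<in> Hinf" "AE z in \<mu>\<^sub>T. cmod (s z) = exp (f z)"
      "\<forall>z\<in>ball 0 1. poisson_integral s z = outer_extension f z"
      "(\<lambda>j. \<integral>w. cmod (outer_extension f (of_real (r j) * w) - s w) \<partial>\<mu>\<^sub>T) \<longlonglongrightarrow> 0"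
    using outer_function_exists[OF f fC r] by blast
  \<comment> \<open>The properties are bundled in one predicate so that a single choice over n
    yields the sequence \<open>h\<close>.\<close>
  define Q where "Q n h \<longleftrightarrow> h \<in> Hinf \<and> (AE z in \<mu>\<^sub>T. cmod (h z) = exp (g n z)) \<and>
      (\<lambda>j. \<integral>w. cmod (outer_extension (g n) (of_real (r j) * w) - h w) \<partial>\<mu>\<^sub>T) \<longlonglongrightarrow> 0" for n h
  have "\<exists>h. Q n h" for n
  proof -
    have "AE z in \<mu>\<^sub>T. g n z \<le> real n" by (simp add: g_def)
    from outer_function_exists[OF gi this r] show ?thesis unfolding Q_def by blast
  qed
  then obtain h where "\<And>n. Q n (h n)" by metis
  then have h: "h n \<in> Hinf" "AE z in \<mu>\<^sub>T. cmod (h n z) = exp (g n z)"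
      "(\<lambda>j. \<integral>w. cmod (outer_extension (g n) (of_real (r j) * w) - h n w) \<partial>\<mu>\<^sub>T) \<longlonglongrightarrow> 0" for n
    unfolding Q_def by blast+
  have sL: "s \<in> Linf" and hL: "h n \<in> Linf" for n using s(1) h(1) by (auto simp: Hinf_def)
  have sm [measurable]: "s \<in> borel_measurable \<mu>\<^sub>T" and hm [measurable]: "h n \<in> borel_measurable \<mu>\<^sub>T" for n
    using LinfD(1)[OF sL] LinfD(1)[OF hL] by auto
  have sk: "AE z in \<mu>\<^sub>T. cmod (s z) = cmod (k z) \<and> s z \<noteq> 0"
    using s(2) k0 by eventually_elim (auto simp: f_def)

  have lns: "AE z in \<mu>\<^sub>T. ln (cmod (s z)) = f z" using s(2) by eventually_elim simp
  \<comment> \<open>The unimodular constant is 1; the prescribed f agrees with the logarithm of |s|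
    up to a null set, which the integral does not see.\<close>
  have "outer s"
    unfolding outer_def
  proof (intro conjI exI[of _ 1] ballI)
    show "s \<in> Hinf" by (rule s(1))
    show "AE w in \<mu>\<^sub>T. s w \<noteq> 0" using sk by eventually_elim simp
    show "integrable \<mu>\<^sub>T (\<lambda>w. ln (cmod (s w)))"
      using lns f by (subst integrable_cong_AE[of _ _ f]) auto
    fix z :: complex assume "z \<in> ball 0 1"
    then have "poisson_integral s z = outer_extension f z" using s(3) by blast
    also have "(\<integral>w. (w + z) / (w - z) * complex_of_real (f w) \<partial>\<mu>\<^sub>T)
        = (\<integral>w. (w + z) / (w - z) * complex_of_real (ln (cmod (s w))) \<partial>\<mu>\<^sub>T)"
    proof (rule integral_cong_AE)
      show "AE w in \<mu>\<^sub>T. (w + z) / (w - z) * complex_of_real (f w)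
          = (w + z) / (w - z) * complex_of_real (ln (cmod (s w)))"
        using lns by eventually_elim simp
    qed measurable
    then have "outer_extension f z = 1 * exp (\<integral>w. (w + z) / (w - z) * complex_of_real (ln (cmod (s w))) \<partial>\<mu>\<^sub>T)"
      by (simp add: outer_extension_def)
    finally show "poisson_integral s z
        = 1 * exp (\<integral>w. (w + z) / (w - z) * complex_of_real (ln (cmod (s w))) \<partial>\<mu>\<^sub>T)" .
  qed simp

  define u where "u z = k z / s z" for z
  have um: "u \<in> borel_measurable \<mu>\<^sub>T" unfolding u_def by measurable
  have uni: "unimodular u" unfolding unimodular_def
    using sk k0 by eventually_elim (auto simp: u_def norm_divide)
  have uL: "u \<in> Linf"
    using uni unfolding unimodular_def by (intro Linf_bounded[OF um, of 1]) (auto elim: eventually_mono)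
  have ku: "AE z in \<mu>\<^sub>T. k z = u z * s z" using sk by eventually_elim (auto simp: u_def)

  have sinv: "(\<lambda>z. 1 / s z) \<in> Lspace \<alpha>"
  proof (rule Lspace_cong_cmod[OF assms(1,5)])
    show "AE z in \<mu>\<^sub>T. cmod (1 / s z) = cmod (1 / k z)"
      using sk by eventually_elim (auto simp: norm_divide)
  qed measurable

  \<comment> \<open>A majorant independent of n: it bounds \<open>s z * h n z\<close> by 1 and
    dominates the pairings at the end.\<close>
  have hk: "AE z in \<mu>\<^sub>T. cmod (h n z) \<le> cmod (1 / k z)" for n
    using h(2)[of n] k0
  proof eventually_elim
    case (elim z)
    have "exp (g n z) \<le> exp (- f z)" by (simp add: g_def)
    also have "\<dots> = cmod (1 / k z)" using elim by (simp add: f_def exp_minus norm_divide field_simps)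
    finally show ?case using elim by simp
  qed
  have sh1: "AE z in \<mu>\<^sub>T. cmod (s z * h n z) \<le> 1" for n
    using hk[of n] sk k0
  proof eventually_elim
    case (elim z)
    then show ?case by (simp add: norm_mult norm_divide field_simps)
  qed
  have shi: "integrable \<mu>\<^sub>T (\<lambda>z. s z * h n z)" for n
    by (rule circle.integrable_const_bound[OF sh1]) measurable

  have mean: "(\<integral>z. s z * h n z \<partial>\<mu>\<^sub>T) = exp (complex_of_real (\<integral>z. f z + g n z \<partial>\<mu>\<^sub>T))" for n
  proof -
    have "(\<integral>z. s z * h n z \<partial>\<mu>\<^sub>T) = outer_extension f 0 * outer_extension (g n) 0"
      by (rule integral_mult_boundary_functions[where r = r and C = "exp C"])
         (intro sL hL s(4) h(3) holomorphic_outer_extension f gi r cmod_outer_extension_le fC; assumption)+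
    also have "\<dots> = exp (complex_of_real (\<integral>z. f z \<partial>\<mu>\<^sub>T) + complex_of_real (\<integral>z. g n z \<partial>\<mu>\<^sub>T))"
      by (simp add: outer_extension_0 exp_add)
    finally show ?thesis using f gi by simp
  qed
  \<comment> \<open>Once n >= -f z the truncation has no effect at z, and f + g n vanishes
    there.\<close>
  have "(\<lambda>n. \<integral>z. f z + g n z \<partial>\<mu>\<^sub>T) \<longlonglongrightarrow> (\<integral>z. 0 \<partial>\<mu>\<^sub>T)"
  proof (rule integral_dominated_convergence[where w = "\<lambda>z. \<bar>f z\<bar>"])
    show "AE z in \<mu>\<^sub>T. (\<lambda>n. f z + g n z) \<longlonglongrightarrow> 0"
    proof (rule AE_I2)
      fix z
      obtain N where N: "- f z \<le> real N" using real_arch_simple by blast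
      have "f z + g n z = 0" if "n \<ge> N" for n
      proof -
        have "real N \<le> real n" using that by simp
        then show ?thesis using N by (simp add: g_def min_def)
      qed
      then have "\<forall>\<^sub>F n in sequentially. f z + g n z = 0"
        by (auto simp: eventually_sequentially)
      then show "(\<lambda>n. f z + g n z) \<longlonglongrightarrow> 0" by (rule tendsto_eventually)
    qed
    show "AE z in \<mu>\<^sub>T. norm (f z + g n z) \<le> \<bar>f z\<bar>" for n
      by (intro AE_I2) (auto simp: g_def)
  qed (use f gi in auto)
  then have "(\<lambda>n. \<integral>z. s z * h n z \<partial>\<mu>\<^sub>T) \<longlonglongrightarrow> exp (complex_of_real 0)"
    unfolding mean by (intro tendsto_exp tendsto_of_real) simp
  from tendsto_Re[OF this] have Re_lim: "(\<lambda>n. Re (\<integral>z. s z * h n z \<partial>\<mu>\<^sub>T)) \<longlonglongrightarrow> 1" by simp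

  \<comment> \<open>The square stands inside the modulus: the integral of
    \<open>cmod (?d n z)\<close> is the squared \<open>L^2\<close> distance to 1 and also an
    \<open>L^1\<close> norm, from which an almost everywhere convergent subsequence can be
    extracted.\<close>
  let ?d = "\<lambda>n z. (s z * h n z - 1)\<^sup>2"
  have di: "integrable \<mu>\<^sub>T (?d n)" for n
  proof (rule circle.integrable_const_bound[of _ 4])
    show "AE z in \<mu>\<^sub>T. cmod (?d n z) \<le> 4"
      using sh1[of n]
    proof eventually_elim
      case (elim z)
      then have "cmod (s z * h n z - 1) \<le> 2"
        using norm_triangle_ineq4[of "s z * h n z" 1] by simp
      then have "(cmod (s z * h n z - 1))\<^sup>2 \<le> 2\<^sup>2" by (intro power_mono) auto
      then show ?case by (simp add: norm_power)
    qed
  qed measurable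
  have "(\<lambda>n. \<integral>z. cmod (?d n z) \<partial>\<mu>\<^sub>T) \<longlonglongrightarrow> 0"
  proof (rule Lim_null_comparison)
    show "(\<lambda>n. 2 - 2 * Re (\<integral>z. s z * h n z \<partial>\<mu>\<^sub>T)) \<longlonglongrightarrow> 0"
      using tendsto_diff[OF tendsto_const tendsto_mult_left[OF Re_lim, of 2], of 2] by simp
    show "\<forall>\<^sub>F n in sequentially. norm (\<integral>z. cmod (?d n z) \<partial>\<mu>\<^sub>T) \<le> 2 - 2 * Re (\<integral>z. s z * h n z \<partial>\<mu>\<^sub>T)"
    proof (intro always_eventually allI)
      fix n
      have int: "integrable \<mu>\<^sub>T (\<lambda>z. 2 :: real)" "integrable \<mu>\<^sub>T (\<lambda>z. 2 * Re (s z * h n z))"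
        by (simp, intro integrable_mult_right integrable_Re shi)
      have "(\<integral>z. cmod (?d n z) \<partial>\<mu>\<^sub>T) \<le> (\<integral>z. 2 - 2 * Re (s z * h n z) \<partial>\<mu>\<^sub>T)"
      proof (rule integral_mono_AE)
        show "integrable \<mu>\<^sub>T (\<lambda>z. cmod (?d n z))" by (rule integrable_norm[OF di])
        show "integrable \<mu>\<^sub>T (\<lambda>z. 2 - 2 * Re (s z * h n z))"
          by (rule Bochner_Integration.integrable_diff[OF int])
        show "AE z in \<mu>\<^sub>T. cmod (?d n z) \<le> 2 - 2 * Re (s z * h n z)"
          using sh1[of n]
        proof eventually_elim
          case (elim z)
          have "cmod (?d n z) = (cmod (s z * h n z - 1))\<^sup>2" by (simp add: norm_power)
          also have "\<dots> = (cmod (s z * h n z))\<^sup>2 + 1 - 2 * Re (s z * h n z)"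
            unfolding cmod_power2 by (simp add: power2_eq_square algebra_simps)
          also have "\<dots> \<le> 2 - 2 * Re (s z * h n z)"
            using power_mono[OF elim norm_ge_zero, of 2] by simp
          finally show ?case .
        qed
      qed
      also have "\<dots> = 2 - 2 * Re (\<integral>z. s z * h n z \<partial>\<mu>\<^sub>T)"
        unfolding Bochner_Integration.integral_diff[OF int] integral_mult_right_zero integral_Re[OF shi] by simp
      finally show "norm (\<integral>z. cmod (?d n z) \<partial>\<mu>\<^sub>T) \<le> 2 - 2 * Re (\<integral>z. s z * h n z \<partial>\<mu>\<^sub>T)" by simp
    qed
  qed
  then obtain p where p: "strict_mono p" "AE z in \<mu>\<^sub>T. (\<lambda>n. ?d (p n) z) \<longlonglongrightarrow> 0"
    using tendsto_L1_AE_subseq[of \<mu>\<^sub>T ?d] di by blast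
  have lim: "AE z in \<mu>\<^sub>T. (\<lambda>n. h (p n) z) \<longlonglongrightarrow> 1 / s z"
    using p(2) sk
  proof eventually_elim
    case (elim z)
    \<comment> \<open>The square root of the modulus undoes the square in \<open>?d\<close>.\<close>
    have "(\<lambda>n. sqrt (cmod (?d (p n) z))) \<longlonglongrightarrow> sqrt (cmod 0)"
      by (intro tendsto_real_sqrt tendsto_norm elim(1))
    then have "(\<lambda>n. s z * h (p n) z - 1) \<longlonglongrightarrow> 0"
      by (subst tendsto_norm_zero_iff[symmetric]) (simp add: norm_power)
    from tendsto_divide[OF LIM_zero_cancel[OF this] tendsto_const[of "s z"]]
    have "(\<lambda>n. s z * h (p n) z / s z) \<longlonglongrightarrow> 1 / s z"
      using elim(2) by blast
    then show ?case using elim(2) by simp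
  qed

  have "(\<lambda>z. 1 / s z) \<in> Hspace \<alpha>"
  proof (rule weak_closure_sequential[OF assms(1,2) sinv h(1)])
    fix \<phi> assume \<phi>: "\<phi> \<in> calL (dual_norm \<alpha>)"
    then have [measurable]: "\<phi> \<in> borel_measurable \<mu>\<^sub>T" by (simp add: calL_def)
    \<comment> \<open>The majorant is the modulus of \<phi>/k, integrable by Hoelder because
      \<open>1/k\<close> has finite extended norm and \<phi> finite extended dual norm.\<close>
    show "(\<lambda>n. \<integral>z. h (p n) z * \<phi> z \<partial>\<mu>\<^sub>T) \<longlonglongrightarrow> (\<integral>z. 1 / s z * \<phi> z \<partial>\<mu>\<^sub>T)"
    proof (rule integral_dominated_convergence[where w = "\<lambda>z. cmod (1 / k z * \<phi> z)"])
      show "integrable \<mu>\<^sub>T (\<lambda>z. cmod (1 / k z * \<phi> z))"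
        by (rule integrable_norm[OF dual_pairing_integrable[OF assms(1,2) kinv \<phi>]])
      show "AE z in \<mu>\<^sub>T. (\<lambda>n. h (p n) z * \<phi> z) \<longlonglongrightarrow> 1 / s z * \<phi> z"
        using lim by eventually_elim (intro tendsto_intros)
      show "AE z in \<mu>\<^sub>T. norm (h (p n) z * \<phi> z) \<le> cmod (1 / k z * \<phi> z)" for n
        using hk[of "p n"] by eventually_elim (simp only: norm_mult mult_right_mono norm_ge_zero)
    qed measurable
  qed
  then show ?thesis using uL uni s(1) \<open>outer s\<close> ku by blast
qed

end
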